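(* For every $n\ge1$, $1\le k\le n$ and $\epsilon>0$, there is a quantum algorithm that $\epsilon$-tests the set $k\text{-Juntas}\subseteq\mathbb{U}_N$ using $O(k\log(k/\epsilon)/\epsilon^2)$ queries to $U$, where the implied constant is independent of $n$, $k$, $\epsilon$.
   Context: Let $n\ge1$, $N=2^n$, $\mathbb{U}_d$ the $d\times d$ unitaries, and $[n]=\{1,\dots,n\}$ indexing the qubits of $(\mathbb{C}^2)^{\otimes n}$. For $T\subseteq[n]$ and $V\in\mathbb{U}_{2^{|T|}}$, $V_T\otimes I_{T^c}$ is the operator acting as $V$ on the qubits in $T$ and as the identity on the others. $k\text{-Juntas}=\{U\in\mathbb{U}_N:\exists T\subseteq[n], |T|=k, \exists V\in\mathbb{U}_{2^k}, U=V_T\otimes I_{T^c}\}$. $\|A\|=\sqrt{\mathrm{tr}(A^\dagger A)}$; $D(A,B)=\min_{\theta\in[0,2\pi)}\frac{1}{\sqrt{2N}}\|e^{i\theta}A-B\|$; $D(A,\mathcal{S})=\inf_{B\in\mathcal{S}}D(A,B)$. For $\mathcal{S}\subseteq\mathbb{U}_N$, $U$ has property $\mathcal{S}$ if $U=e^{i\theta}V$ for some $V\in\mathcal{S}$, real $\theta$; $U$ is $\epsilon$-far from $\mathcal{S}$ if $D(U,V)\ge\epsilon$ for all $V\in\mathcal{S}$. Testing model: the unknown $U\in\mathbb{U}_N$ is a black box; the algorithm may prepare arbitrary states on the system plus an ancilla, apply $U\otimes I$ (one query each), interleaved with arbitrary fixed quantum operations, and measure. It $\epsilon$-tests $\mathcal{S}$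 if for every $U\in\mathbb{U}_N$ it accepts with probability $\ge2/3$ when $U$ has property $\mathcal{S}$ and with probability $\le1/3$ when $U$ is $\epsilon$-far from $\mathcal{S}$.
   Formalization: The query bound is stated as C·k·max(1, ln(k/ε))/ε², since log(k/ε) is zero or negative when ε ≥ k; for k = 1, ε = 1 the literal bound would allow no queries, although X⊗X is 1-far from the 1-juntas and must be told apart from the identity. *)

theory Defs
  imports "HOL-Analysis.Analysis" "Jordan_Normal_Form.Matrix"
begin

(* Complex matrices/vectors from Jordan_Normal_Form.Matrix. Basis states of n qubits are
   indexed by x < 2^n; qubit j (0-based, j < n) of x is bit j of x. *)

definition adj :: "complex mat \<Rightarrow> complex mat" where
  "adj A = mat (dim_col A) (dim_row A) (\<lambda>(i,j). cnj (A $$ (j,i)))"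

definition unitary_mat :: "nat \<Rightarrow> complex mat \<Rightarrow> bool" where
  "unitary_mat d U \<longleftrightarrow> U \<in> carrier_mat d d \<and> adj U * U = 1\<^sub>m d"

definition hs_norm :: "complex mat \<Rightarrow> real" where
  "hs_norm A = sqrt (\<Sum>i<dim_row A. \<Sum>j<dim_col A. (cmod (A $$ (i,j)))\<^sup>2)"

definition dist_ph :: "nat \<Rightarrow> complex mat \<Rightarrow> complex mat \<Rightarrow> real" where
  "dist_ph N A B = Inf ((\<lambda>\<theta>. hs_norm (exp (\<i> * complex_of_real \<theta>) \<cdot>\<^sub>m A - B) / sqrt (2 * real N))
                        ` {0..<2*pi})"

definition qbit :: "nat \<Rightarrow> nat \<Rightarrow> bool" where
  "qbit x j \<longleftrightarrow> odd (x div 2 ^ j)"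

(* index of the restriction of basis state x to the qubits in T (listed increasingly) *)
definition sub_index :: "nat set \<Rightarrow> nat \<Rightarrow> nat" where
  "sub_index T x = (\<Sum>i<card T. if qbit x (sorted_list_of_set T ! i) then 2 ^ i else 0)"

(* V_T \<otimes> I_{T^c} on n qubits *)
definition embed_op :: "nat \<Rightarrow> nat set \<Rightarrow> complex mat \<Rightarrow> complex mat" where
  "embed_op n T V = mat (2^n) (2^n) (\<lambda>(x,y).
      if (\<forall>j<n. j \<notin> T \<longrightarrow> qbit x j = qbit y j) then V $$ (sub_index T x, sub_index T y) else 0)"

definition juntas :: "nat \<Rightarrow> nat \<Rightarrow> complex mat set" where
  "juntas n k = {U. \<exists>T. T \<subseteq> {..<n} \<and> card T = k \<and>
                    (\<exists>V. unitary_mat (2^k) V \<and> U = embed_op n T V)}"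

definition has_property :: "complex mat set \<Rightarrow> complex mat \<Rightarrow> bool" where
  "has_property S U \<longleftrightarrow> (\<exists>\<theta>::real. \<exists>V\<in>S. U = exp (\<i> * complex_of_real \<theta>) \<cdot>\<^sub>m V)"

definition eps_far :: "nat \<Rightarrow> complex mat set \<Rightarrow> real \<Rightarrow> complex mat \<Rightarrow> bool" where
  "eps_far N S \<epsilon> U \<longleftrightarrow> (\<forall>V\<in>S. dist_ph N U V \<ge> \<epsilon>)"

(* U \<otimes> I_d on system (first factor, dimension N) plus ancilla (dimension d):
   basis index of |x>|a> is x*d + a *)
definition kron_id :: "nat \<Rightarrow> complex mat \<Rightarrow> complex mat" where
  "kron_id d U = mat (dim_row U * d) (dim_col U * d)
      (\<lambda>(i,j). if i mod d = j mod d then U $$ (i div d, j div d) else 0)"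

definition vnorm_sq :: "complex vec \<Rightarrow> real" where
  "vnorm_sq v = (\<Sum>i<dim_vec v. (cmod (v $ i))\<^sup>2)"

(* A query algorithm: ancilla dimension, initial state on system+ancilla, the fixed
   operations W_1..W_q applied after each of the q queries U\<otimes>I, and the accepting projector. *)
record qalg =
  anc :: nat
  init :: "complex vec"
  ops :: "complex mat list"
  acc :: "complex mat"

definition valid_qalg :: "nat \<Rightarrow> qalg \<Rightarrow> bool" where
  "valid_qalg N A \<longleftrightarrow> anc A \<ge> 1 \<and> init A \<in> carrier_vec (N * anc A) \<and> vnorm_sq (init A) = 1
     \<and> (\<forall>W\<in>set (ops A). unitary_mat (N * anc A) W)
     \<and> acc A \<in> carrier_mat (N * anc A) (N * anc A) \<and> acc A * acc A = acc A \<and> adj (acc A) = acc A"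

definition num_queries :: "qalg \<Rightarrow> nat" where
  "num_queries A = length (ops A)"

definition final_state :: "qalg \<Rightarrow> complex mat \<Rightarrow> complex vec" where
  "final_state A U = fold (\<lambda>W s. W *\<^sub>v (kron_id (anc A) U *\<^sub>v s)) (ops A) (init A)"

definition accept_prob :: "qalg \<Rightarrow> complex mat \<Rightarrow> real" where
  "accept_prob A U = vnorm_sq (acc A *\<^sub>v final_state A U)"

definition eps_tests :: "nat \<Rightarrow> qalg \<Rightarrow> complex mat set \<Rightarrow> real \<Rightarrow> bool" where
  "eps_tests N A S \<epsilon> \<longleftrightarrow> (\<forall>U. unitary_mat N U \<longrightarrow>
      (has_property S U \<longrightarrow> accept_prob A U \<ge> 2/3) \<and>
      (eps_far N S \<epsilon> U \<longrightarrow> accept_prob A U \<le> 1/3))"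

end

theory Submission
  imports Defs "Jordan_Normal_Form.Determinant" "HOL-Library.Nat_Bijection"
begin

text \<open>
  Apply \<open>U\<close> to one half of a maximally entangled state and measure in the basis of the Pauli
  operators \<open>X\<^sup>aZ\<^sup>b\<close>, indexed by sets \<open>a\<close>, \<open>b\<close> of qubits. The outcome \<open>(a, b)\<close> has probability equal to the
  squared modulus of the Pauli coefficient of \<open>U\<close>, and the operator acts on the qubits \<open>a \<union> b\<close>.
  Sample \<open>q = \<lceil>6k/\<epsilon>\<^sup>2\<rceil>\<close> times and accept if at most \<open>k\<close> qubits have been seen. Juntas are always accepted.

  For a set \<open>T\<close> of \<open>k\<close> qubits, the weight of the outcomes inside \<open>T\<close> is the normalized squared
  Hilbert-Schmidt norm of the normalized partial trace \<open>M\<close> of \<open>U\<close> over the complement of \<open>T\<close>.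
  As \<open>M\<close> is a contraction, its unitary polar factor \<open>V\<close> satisfies \<open>Re tr(V\<^sup>\<dagger>M) \<ge> tr(M\<^sup>\<dagger>M)\<close>,
  so that weight \<open>1 - \<delta>\<close> inside \<open>T\<close> yields a junta at distance at most \<open>\<surd>\<delta>\<close>. Hence, if \<open>U\<close> is
  \<open>\<epsilon>\<close>-far, then as long as at most \<open>k\<close> qubits have been seen every sample shows a new one with
  probability at least \<open>\<epsilon>\<^sup>2\<close>, and a potential that halves with every new qubit bounds the
  acceptance probability by \<open>2\<^sup>k (1 - \<epsilon>\<^sup>2/2)\<^sup>q\<close>. For \<open>\<epsilon> > 1\<close> no unitary is \<open>\<epsilon>\<close>-far and no query is needed.
\<close>

unbundle no vec_syntax

section \<open>Matrices indexed by a finite set\<close>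

definition inner_on :: "'a set \<Rightarrow> ('a \<Rightarrow> complex) \<Rightarrow> ('a \<Rightarrow> complex) \<Rightarrow> complex" where
  "inner_on A x y = (\<Sum>j\<in>A. cnj (x j) * y j)"

definition sqnorm_on :: "'a set \<Rightarrow> ('a \<Rightarrow> complex) \<Rightarrow> real" where
  "sqnorm_on A x = (\<Sum>j\<in>A. (cmod (x j))\<^sup>2)"

definition app_on :: "'a set \<Rightarrow> ('i \<Rightarrow> 'a \<Rightarrow> complex) \<Rightarrow> ('a \<Rightarrow> complex) \<Rightarrow> 'i \<Rightarrow> complex" where
  "app_on A M x i = (\<Sum>j\<in>A. M i j * x j)"

definition hs_inner_on :: "'a set \<Rightarrow> ('a \<Rightarrow> 'a \<Rightarrow> complex) \<Rightarrow> ('a \<Rightarrow> 'a \<Rightarrow> complex) \<Rightarrow> complex" where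
  "hs_inner_on A M N = (\<Sum>i\<in>A. inner_on A (M i) (N i))"

definition hs_sqnorm_on :: "'a set \<Rightarrow> ('a \<Rightarrow> 'a \<Rightarrow> complex) \<Rightarrow> real" where
  "hs_sqnorm_on A M = (\<Sum>i\<in>A. sqnorm_on A (M i))"

definition orthonormal_on :: "'i set \<Rightarrow> 'a set \<Rightarrow> ('i \<Rightarrow> 'a \<Rightarrow> complex) \<Rightarrow> bool" where
  "orthonormal_on I A f \<longleftrightarrow> (\<forall>i\<in>I. \<forall>j\<in>I. inner_on A (f i) (f j) = of_bool (i = j))"

definition contraction_on :: "'a set \<Rightarrow> ('a \<Rightarrow> 'a \<Rightarrow> complex) \<Rightarrow> bool" where
  "contraction_on A M \<longleftrightarrow> (\<forall>x. sqnorm_on A (app_on A M x) \<le> sqnorm_on A x)"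

definition adj_mult_on :: "'a set \<Rightarrow> ('a \<Rightarrow> 'a \<Rightarrow> complex) \<Rightarrow> ('a \<Rightarrow> 'a \<Rightarrow> complex) \<Rightarrow> 'a \<Rightarrow> 'a \<Rightarrow> complex" where
  "adj_mult_on A V M j l = inner_on A (\<lambda>i. V i j) (\<lambda>i. M i l)"

lemma cnj_of_bool [simp]: "cnj (of_bool P) = of_bool P"
  by simp

lemma inner_on_self: "inner_on A x x = complex_of_real (sqnorm_on A x)"
  unfolding inner_on_def sqnorm_on_def of_real_sum complex_norm_square by (simp add: mult.commute)

lemma sqnorm_on_nonneg: "0 \<le> sqnorm_on A x"
  by (simp add: sqnorm_on_def sum_nonneg)

lemma sqnorm_on_eq_0: "finite A \<Longrightarrow> sqnorm_on A x = 0 \<Longrightarrow> j \<in> A \<Longrightarrow> x j = 0"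
  by (simp add: sqnorm_on_def sum_nonneg_eq_0_iff)

lemma hs_inner_on_self: "hs_inner_on A M M = complex_of_real (hs_sqnorm_on A M)"
  by (simp add: hs_inner_on_def hs_sqnorm_on_def inner_on_self)

lemma inner_on_commute: "inner_on A y x = cnj (inner_on A x y)"
  by (simp add: inner_on_def mult.commute)

lemma inner_on_cnj: "inner_on A (\<lambda>i. cnj (x i)) (\<lambda>i. cnj (y i)) = cnj (inner_on A x y)"
  by (simp add: inner_on_def)

lemma hs_inner_on_commute: "hs_inner_on A N M = cnj (hs_inner_on A M N)"
  unfolding hs_inner_on_def cnj_sum by (intro sum.cong refl inner_on_commute)

lemma inner_on_add_right: "inner_on A x (\<lambda>i. y i + z i) = inner_on A x y + inner_on A x z"
  and inner_on_add_left: "inner_on A (\<lambda>i. y i + z i) x = inner_on A y x + inner_on A z x"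
  and inner_on_scale_right: "inner_on A x (\<lambda>i. c * y i) = c * inner_on A x y"
  and inner_on_scale_left: "inner_on A (\<lambda>i. c * y i) x = cnj c * inner_on A y x"
  unfolding inner_on_def by (simp_all add: algebra_simps sum.distrib sum_distrib_left)

lemma inner_on_diff_right: "inner_on A x (\<lambda>i. y i - z i) = inner_on A x y - inner_on A x z"
  and inner_on_diff_left: "inner_on A (\<lambda>i. y i - z i) x = inner_on A y x - inner_on A z x"
  unfolding inner_on_def by (simp_all add: algebra_simps sum_subtractf)

lemmas inner_on_linear = inner_on_add_right inner_on_add_left inner_on_scale_right inner_on_scale_left

lemma app_on_add: "app_on A M (\<lambda>i. y i + z i) = (\<lambda>i. app_on A M y i + app_on A M z i)"
  and app_on_scale: "app_on A M (\<lambda>i. c * y i) = (\<lambda>i. c * app_on A M y i)"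
  unfolding app_on_def by (simp_all add: algebra_simps sum.distrib sum_distrib_left)

lemma sqnorm_on_diff:
  "sqnorm_on A (\<lambda>j. x j - y j) = sqnorm_on A x + sqnorm_on A y - 2 * Re (inner_on A y x)"
proof -
  have "(cmod (a - b))\<^sup>2 = (cmod a)\<^sup>2 + (cmod b)\<^sup>2 - 2 * Re (cnj b * a)" for a b
    unfolding cmod_power2 by (simp add: power2_eq_square algebra_simps)
  then show ?thesis
    by (simp add: sqnorm_on_def inner_on_def sum.distrib sum_subtractf sum_distrib_left)
qed

lemma hs_sqnorm_on_diff:
  "hs_sqnorm_on A (\<lambda>i j. M i j - N i j) = hs_sqnorm_on A M + hs_sqnorm_on A N - 2 * Re (hs_inner_on A N M)"
  by (simp add: hs_sqnorm_on_def hs_inner_on_def sqnorm_on_diff sum.distrib sum_subtractf sum_distrib_left)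

lemma Re_inner_on_le: "Re (inner_on A x y) \<le> (sqnorm_on A x + sqnorm_on A y) / 2"
  using sqnorm_on_nonneg[of A "\<lambda>j. y j - x j"] by (simp add: sqnorm_on_diff)

lemma inner_on_cong:
  "(\<And>i. i \<in> A \<Longrightarrow> x i = x' i) \<Longrightarrow> (\<And>i. i \<in> A \<Longrightarrow> y i = y' i) \<Longrightarrow> inner_on A x y = inner_on A x' y'"
  by (simp add: inner_on_def)

lemma hs_inner_on_cong:
  assumes "\<And>i j. i \<in> A \<Longrightarrow> j \<in> A \<Longrightarrow> M i j = M' i j" "\<And>i j. i \<in> A \<Longrightarrow> j \<in> A \<Longrightarrow> N i j = N' i j"
  shows "hs_inner_on A M N = hs_inner_on A M' N'"
  unfolding hs_inner_on_def by (intro sum.cong refl inner_on_cong assms)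

lemma orthonormal_on_cong:
  assumes "\<And>i j. i \<in> I \<Longrightarrow> j \<in> A \<Longrightarrow> f i j = g i j"
  shows "orthonormal_on I A f \<longleftrightarrow> orthonormal_on I A g"
proof -
  have "inner_on A (f i) (f j) = inner_on A (g i) (g j)" if "i \<in> I" "j \<in> I" for i j
    using that by (intro inner_on_cong assms)
  then show ?thesis
    by (simp add: orthonormal_on_def)
qed

lemma inner_on_reindex: "bij_betw f A B \<Longrightarrow> inner_on B x y = inner_on A (\<lambda>i. x (f i)) (\<lambda>i. y (f i))"
  unfolding inner_on_def by (rule sum.reindex_bij_betw[symmetric])

lemma sqnorm_on_reindex: "bij_betw f A B \<Longrightarrow> sqnorm_on B x = sqnorm_on A (\<lambda>i. x (f i))"
  unfolding sqnorm_on_def by (rule sum.reindex_bij_betw[symmetric])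

lemma hs_inner_on_reindex:
  assumes "bij_betw f A B"
  shows "hs_inner_on B M N = hs_inner_on A (\<lambda>i j. M (f i) (f j)) (\<lambda>i j. N (f i) (f j))"
  unfolding hs_inner_on_def inner_on_reindex[OF assms] by (rule sum.reindex_bij_betw[OF assms, symmetric])

lemma hs_sqnorm_on_reindex:
  assumes "bij_betw f A B"
  shows "hs_sqnorm_on B M = hs_sqnorm_on A (\<lambda>i j. M (f i) (f j))"
  unfolding hs_sqnorm_on_def sqnorm_on_reindex[OF assms] by (rule sum.reindex_bij_betw[OF assms, symmetric])

lemma orthonormal_on_reindex:
  assumes "bij_betw f A B"
  shows "orthonormal_on B B V \<longleftrightarrow> orthonormal_on A A (\<lambda>i j. V (f i) (f j))"
  using bij_betw_imp_inj_on[OF assms] bij_betw_imp_surj_on[OF assms]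
  unfolding orthonormal_on_def inner_on_reindex[OF assms] by (auto simp: inj_on_eq_iff)

lemma inner_on_unit_left: "finite A \<Longrightarrow> j \<in> A \<Longrightarrow> inner_on A (\<lambda>l. of_bool (l = j)) x = x j"
  by (simp add: inner_on_def)

lemma app_on_unit: "finite A \<Longrightarrow> j \<in> A \<Longrightarrow> app_on A M (\<lambda>l. of_bool (l = j)) = (\<lambda>i. M i j)"
  by (rule ext) (simp add: app_on_def)

lemma app_on_one: "finite A \<Longrightarrow> i \<in> A \<Longrightarrow> app_on A (\<lambda>i j. of_bool (i = j)) x i = x i"
  by (simp add: app_on_def)

lemma orthonormal_on_one: "finite A \<Longrightarrow> orthonormal_on A A (\<lambda>i j. of_bool (i = j))"
  by (simp add: orthonormal_on_def inner_on_def)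

lemma inner_on_adj_mult_on:
  "inner_on A x (app_on A (adj_mult_on A V M) y) = inner_on A (app_on A V x) (app_on A M y)"
proof -
  have "inner_on A x (app_on A (adj_mult_on A V M) y)
     = (\<Sum>j\<in>A. \<Sum>l\<in>A. \<Sum>i\<in>A. cnj (x j) * cnj (V i j) * (M i l * y l))"
    unfolding inner_on_def app_on_def adj_mult_on_def sum_distrib_left sum_distrib_right
    by (simp add: algebra_simps)
  also have "\<dots> = (\<Sum>j\<in>A. \<Sum>i\<in>A. \<Sum>l\<in>A. cnj (x j) * cnj (V i j) * (M i l * y l))"
    by (rule sum.cong[OF refl sum.swap])
  also have "\<dots> = (\<Sum>i\<in>A. \<Sum>j\<in>A. \<Sum>l\<in>A. cnj (x j) * cnj (V i j) * (M i l * y l))"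
    by (rule sum.swap)
  also have "\<dots> = inner_on A (app_on A V x) (app_on A M y)"
    unfolding inner_on_def app_on_def cnj_sum sum_product by (simp add: algebra_simps)
  finally show ?thesis .
qed

lemma hs_inner_on_eq_trace: "hs_inner_on A V M = (\<Sum>j\<in>A. adj_mult_on A V M j j)"
  unfolding hs_inner_on_def adj_mult_on_def inner_on_def by (rule sum.swap)

lemma hs_sqnorm_on_orthonormal:
  assumes "orthonormal_on A A (\<lambda>j i. V i j)"
  shows "hs_sqnorm_on A V = card A"
proof -
  have "complex_of_real (hs_sqnorm_on A V) = complex_of_real (card A)"
    unfolding hs_inner_on_self[symmetric] hs_inner_on_eq_trace
    using assms by (simp add: adj_mult_on_def orthonormal_on_def)
  then show ?thesis
    by (simp only: of_real_eq_iff)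
qed

lemma inner_on_isometry:
  assumes "finite A" "orthonormal_on A A (\<lambda>j i. V i j)"
  shows "inner_on A (app_on A V x) (app_on A V y) = inner_on A x y"
proof -
  have "inner_on A (app_on A V x) (app_on A V y) = inner_on A x (app_on A (adj_mult_on A V V) y)"
    by (rule inner_on_adj_mult_on[symmetric])
  also have "\<dots> = inner_on A x y"
    using assms by (intro inner_on_cong) (simp_all add: app_on_def adj_mult_on_def orthonormal_on_def)
  finally show ?thesis .
qed

lemma contraction_on_isometry:
  assumes "finite A" "orthonormal_on A A (\<lambda>j i. V i j)"
  shows "contraction_on A V"
proof -
  have "complex_of_real (sqnorm_on A (app_on A V x)) = complex_of_real (sqnorm_on A x)" for x
    using inner_on_isometry[OF assms, of x x] by (simp only: inner_on_self)
  then show ?thesis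
    by (simp only: of_real_eq_iff contraction_on_def order_refl simp_thms)
qed

lemma contraction_on_compression:
  fixes f :: "'b \<Rightarrow> 'a"
  assumes finite_A: "finite A" and f_embeds: "inj_on f B" "f ` B \<subseteq> A" and M_contraction: "contraction_on A M"
  shows "contraction_on B (\<lambda>i j. M (f i) (f j))"
  unfolding contraction_on_def
proof
  fix x :: "'b \<Rightarrow> complex"
  define y where "y i = (if i \<in> f ` B then x (the_inv_into B f i) else 0)" for i
  have y_image: "y (f j) = x j" if "j \<in> B" for j
    using that f_embeds by (simp add: y_def the_inv_into_f_f)
  have app_y: "app_on A M y i = app_on B (\<lambda>i j. M i (f j)) x i" for i
  proof -
    have "app_on A M y i = (\<Sum>l\<in>f ` B. M i l * y l)"
      unfolding app_on_def using finite_A f_embeds by (intro sum.mono_neutral_right) (auto simp: y_def)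
    also have "\<dots> = app_on B (\<lambda>i j. M i (f j)) x i"
      using f_embeds(1) by (simp add: sum.reindex app_on_def y_image)
    finally show ?thesis .
  qed
  have "sqnorm_on B (app_on B (\<lambda>i j. M (f i) (f j)) x) = (\<Sum>i\<in>f ` B. (cmod (app_on A M y i))\<^sup>2)"
    using f_embeds(1) by (simp add: sqnorm_on_def sum.reindex app_y) (simp add: app_on_def)
  also have "\<dots> \<le> sqnorm_on A (app_on A M y)"
    unfolding sqnorm_on_def using finite_A f_embeds by (intro sum_mono2) auto
  also have "\<dots> \<le> sqnorm_on A y"
    using M_contraction by (simp add: contraction_on_def)
  also have "\<dots> = (\<Sum>i\<in>f ` B. (cmod (y i))\<^sup>2)"
    unfolding sqnorm_on_def using finite_A f_embeds by (intro sum.mono_neutral_right) (auto simp: y_def)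
  also have "\<dots> = sqnorm_on B x"
    using f_embeds(1) by (simp add: sqnorm_on_def sum.reindex y_image)
  finally show "sqnorm_on B (app_on B (\<lambda>i j. M (f i) (f j)) x) \<le> sqnorm_on B x" .
qed

lemma contraction_on_average:
  assumes I_finite_nonempty: "finite I" "I \<noteq> {}" and M_contraction: "\<And>i. i \<in> I \<Longrightarrow> contraction_on A (M i)"
  shows "contraction_on A (\<lambda>x y. (\<Sum>i\<in>I. M i x y) / card I)"
  unfolding contraction_on_def
proof
  fix v
  let ?c = "real (card I)"
  have card_pos: "?c > 0"
    using I_finite_nonempty by (simp add: card_gt_0_iff)
  have "(cmod (app_on A (\<lambda>x y. (\<Sum>i\<in>I. M i x y) / card I) v x))\<^sup>2
      \<le> (\<Sum>i\<in>I. (cmod (app_on A (M i) v x))\<^sup>2) / ?c" for x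
  proof -
    have "app_on A (\<lambda>x y. (\<Sum>i\<in>I. M i x y) / card I) v x = (\<Sum>i\<in>I. app_on A (M i) v x) / card I"
      unfolding app_on_def by (subst sum.swap) (simp add: sum_divide_distrib sum_distrib_right)
    then have "(cmod (app_on A (\<lambda>x y. (\<Sum>i\<in>I. M i x y) / card I) v x))\<^sup>2
        = (cmod (\<Sum>i\<in>I. app_on A (M i) v x))\<^sup>2 / ?c\<^sup>2"
      by (simp add: norm_divide power_divide)
    also have "\<dots> \<le> (\<Sum>i\<in>I. cmod (app_on A (M i) v x))\<^sup>2 / ?c\<^sup>2"
      by (intro divide_right_mono power_mono norm_sum norm_ge_zero) simp
    also have "\<dots> \<le> (?c * (\<Sum>i\<in>I. (cmod (app_on A (M i) v x))\<^sup>2)) / ?c\<^sup>2"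
      using sum_squared_le_sum_of_squares[of "\<lambda>i. cmod (app_on A (M i) v x)" I]
      by (intro divide_right_mono) (simp_all add: mult.commute)
    finally show ?thesis
      using card_pos by (simp add: power2_eq_square)
  qed
  then have "sqnorm_on A (app_on A (\<lambda>x y. (\<Sum>i\<in>I. M i x y) / card I) v)
      \<le> (\<Sum>x\<in>A. (\<Sum>i\<in>I. (cmod (app_on A (M i) v x))\<^sup>2) / ?c)"
    unfolding sqnorm_on_def by (rule sum_mono)
  also have "\<dots> = (\<Sum>i\<in>I. sqnorm_on A (app_on A (M i) v)) / ?c"
    unfolding sum_divide_distrib[symmetric] sqnorm_on_def by (subst sum.swap) (rule refl)
  also have "\<dots> \<le> (\<Sum>i\<in>I. sqnorm_on A v) / ?c"
    using M_contraction by (intro divide_right_mono sum_mono) (auto simp: contraction_on_def)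
  also have "\<dots> = sqnorm_on A v"
    using card_pos by simp
  finally show "sqnorm_on A (app_on A (\<lambda>x y. (\<Sum>i\<in>I. M i x y) / card I) v) \<le> sqnorm_on A v" .
qed

section \<open>Rounding a contraction to a unitary\<close>

lemma orthonormal_on_entry_le_1:
  assumes "finite A" "orthonormal_on I A V" "i \<in> I" "j \<in> A"
  shows "cmod (V i j) \<le> 1"
proof -
  have "complex_of_real (sqnorm_on A (V i)) = 1"
    using assms by (simp add: orthonormal_on_def flip: inner_on_self)
  then have "sqnorm_on A (V i) = 1"
    using of_real_eq_1_iff by blast
  moreover have "(cmod (V i j))\<^sup>2 \<le> sqnorm_on A (V i)"
    unfolding sqnorm_on_def by (rule member_le_sum) (use assms in auto)
  ultimately have "(cmod (V i j))\<^sup>2 \<le> 1\<^sup>2"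
    by simp
  then show ?thesis
    by (rule power2_le_imp_le) simp
qed

lemma compact_PiE_UNIV:
  fixes S :: "'b \<Rightarrow> 'c::topological_space set"
  assumes "\<And>i. compact (S i)"
  shows "compact (PiE UNIV S)"
proof -
  have "compactin (product_topology (\<lambda>_. euclidean) UNIV) (PiE UNIV S)"
    using assms by (subst compactin_PiE) auto
  then show ?thesis
    by (metis compactin_euclidean_iff euclidean_product_topology)
qed

lemma continuous_on_apply: "continuous_on S (\<lambda>f::'b \<Rightarrow> 'c::topological_space. f p)"
  by (rule continuous_on_subset[OF continuous_on_product_coordinates subset_UNIV])

lemma compact_orthonormal_on:
  "compact {f::'i \<times> 'a \<Rightarrow> complex. (\<forall>p. f p \<in> cball 0 1) \<and> orthonormal_on I A (curry f)}"
proof -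
  let ?C = "PiE UNIV (\<lambda>_::'i \<times> 'a. cball (0::complex) 1)"
  let ?O = "\<Inter>i\<in>I. \<Inter>l\<in>I. {f. inner_on A (curry f i) (curry f l) = of_bool (i = l)}"
  have "compact ?C"
    by (rule compact_PiE_UNIV) simp
  moreover have "closed ?O"
    unfolding inner_on_def curry_def
    by (intro closed_INT ballI closed_Collect_eq continuous_intros continuous_on_apply)
  ultimately have "compact (?C \<inter> ?O)"
    by (rule compact_Int_closed)
  moreover have "?C \<inter> ?O = {f. (\<forall>p. f p \<in> cball 0 1) \<and> orthonormal_on I A (curry f)}"
    unfolding orthonormal_on_def by auto
  ultimately show ?thesis
    by simp
qed

text \<open>A maximizer is the unitary factor of a polar decomposition of \<open>M\<close>.\<close>

definition maximally_aligned :: "'a set \<Rightarrow> ('a \<Rightarrow> 'a \<Rightarrow> complex) \<Rightarrow> ('a \<Rightarrow> 'a \<Rightarrow> complex) \<Rightarrow> bool" where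
  "maximally_aligned A M V \<longleftrightarrow> orthonormal_on A A V \<and>
     (\<forall>W. orthonormal_on A A W \<longrightarrow> Re (hs_inner_on A W M) \<le> Re (hs_inner_on A V M))"

lemma maximally_aligned_exists:
  fixes M :: "'a \<Rightarrow> 'a \<Rightarrow> complex"
  assumes finite_A: "finite A"
  shows "\<exists>V. maximally_aligned A M V"
proof -
  define F where "F f = Re (hs_inner_on A (curry f) M)" for f :: "'a \<times> 'a \<Rightarrow> complex"
  let ?K = "{f::'a \<times> 'a \<Rightarrow> complex. (\<forall>p. f p \<in> cball 0 1) \<and> orthonormal_on A A (curry f)}"
  define restr :: "('a \<Rightarrow> 'a \<Rightarrow> complex) \<Rightarrow> 'a \<times> 'a \<Rightarrow> complex"
    where "restr W = (\<lambda>(i,j). if i \<in> A \<and> j \<in> A then W i j else 0)" for W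
  have restr_admissible: "restr W \<in> ?K" if W_orthonormal: "orthonormal_on A A W" for W
  proof -
    have "orthonormal_on A A (curry (restr W))"
      using W_orthonormal by (subst orthonormal_on_cong[of _ _ _ W]) (simp_all add: restr_def)
    then show ?thesis
      using orthonormal_on_entry_le_1[OF finite_A W_orthonormal] by (auto simp: restr_def)
  qed
  have "?K \<noteq> {}"
    using restr_admissible[OF orthonormal_on_one[OF finite_A]] by blast
  moreover have "continuous_on ?K F"
    unfolding F_def hs_inner_on_def inner_on_def curry_def
    by (intro continuous_intros continuous_on_apply)
  ultimately obtain f where f_maximal: "f \<in> ?K" "\<forall>g\<in>?K. F g \<le> F f"
    using continuous_attains_sup[OF compact_orthonormal_on] by blast
  have "Re (hs_inner_on A W M) \<le> Re (hs_inner_on A (curry f) M)" if W_orthonormal: "orthonormal_on A A W" for W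
  proof -
    have "Re (hs_inner_on A W M) = F (restr W)"
      unfolding F_def by (intro arg_cong[where f=Re] hs_inner_on_cong) (simp_all add: restr_def)
    then show ?thesis
      using f_maximal(2) restr_admissible[OF W_orthonormal] by (simp add: F_def)
  qed
  then show ?thesis
    using f_maximal(1) by (auto simp: maximally_aligned_def)
qed

lemma orthonormal_on_rank_one_update:
  assumes V_orthonormal: "orthonormal_on I A V" and c_isometric: "c + cnj c + c * cnj c * inner_on A u u = 0"
  shows "orthonormal_on I A (\<lambda>i j. V i j + c * app_on A V u i * cnj (u j))"
  unfolding orthonormal_on_def
proof (intro ballI)
  fix i l assume indices: "i \<in> I" "l \<in> I"
  let ?a = "app_on A V u i" and ?b = "app_on A V u l"
  have "inner_on A (V i) (\<lambda>j. cnj (u j)) = cnj ?a" "inner_on A (\<lambda>j. cnj (u j)) (V l) = ?b"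
    "inner_on A (\<lambda>j. cnj (u j)) (\<lambda>j. cnj (u j)) = inner_on A u u"
    unfolding inner_on_def app_on_def by (simp_all add: mult.commute)
  then have "inner_on A (\<lambda>j. V i j + c * ?a * cnj (u j)) (\<lambda>j. V l j + c * ?b * cnj (u j))
     = of_bool (i = l) + cnj ?a * ?b * (c + cnj c + c * cnj c * inner_on A u u)"
    unfolding inner_on_linear using V_orthonormal indices by (simp add: orthonormal_on_def algebra_simps)
  then show "inner_on A (\<lambda>j. V i j + c * ?a * cnj (u j)) (\<lambda>j. V l j + c * ?b * cnj (u j)) = of_bool (i = l)"
    using c_isometric by simp
qed

lemma hs_inner_on_rank_one_update:
  "hs_inner_on A (\<lambda>i j. V i j + c * app_on A V u i * cnj (u j)) M
     = hs_inner_on A V M + cnj c * inner_on A (app_on A V u) (app_on A M u)"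
proof -
  have "inner_on A (\<lambda>j. V i j + c * app_on A V u i * cnj (u j)) (M i)
      = inner_on A (V i) (M i) + cnj c * (cnj (app_on A V u i) * app_on A M u i)" for i
    unfolding inner_on_linear by (simp add: inner_on_def app_on_def mult.commute)
  then show ?thesis
    by (simp add: hs_inner_on_def inner_on_def[of _ "app_on A V u"] sum.distrib sum_distrib_left)
qed

text \<open>Rotating the phase of a single vector cannot improve a maximizer, which forces the quadratic
  form of \<open>V\<^sup>\<dagger>M\<close> to be real and nonnegative.\<close>

lemma maximally_aligned_form_nonneg:
  assumes finite_A: "finite A" and V_maximal: "maximally_aligned A M V"
  defines "h u \<equiv> inner_on A (app_on A V u) (app_on A M u)"
  shows "h u = of_real (cmod (h u))"
proof (cases "sqnorm_on A u = 0 \<or> h u = 0")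
  case True
  then have "(\<forall>j\<in>A. u j = 0) \<or> h u = 0"
    using sqnorm_on_eq_0[OF finite_A] by blast
  then have "h u = 0"
    by (auto simp: h_def inner_on_def app_on_def)
  then show ?thesis
    by simp
next
  case False
  define s where "s = sqnorm_on A u"
  have s_pos: "s > 0"
    using False sqnorm_on_nonneg[of A u] by (simp add: s_def)
  define w where "w = sgn (h u)"
  have w_unimodular: "w * cnj w = 1"
    using False by (simp add: w_def norm_sgn flip: complex_norm_square)
  have "h u = w * cmod (h u)"
    using False by (simp add: w_def sgn_eq)
  then have w_aligns: "cnj w * h u = cmod (h u)"
    using w_unimodular by (metis mult.assoc mult.commute mult_1)
  define c where "c = (w - 1) / of_real s"
  have c_isometric: "c + cnj c + c * cnj c * inner_on A u u = 0"
    unfolding inner_on_self s_def[symmetric] using s_pos w_unimodular by (simp add: c_def field_simps)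
  have "Re (hs_inner_on A V M + cnj c * h u) \<le> Re (hs_inner_on A V M)"
    using V_maximal orthonormal_on_rank_one_update[OF _ c_isometric]
    unfolding maximally_aligned_def h_def hs_inner_on_rank_one_update[symmetric] by blast
  moreover have "cnj c * h u = (cmod (h u) - h u) / of_real s"
    by (simp add: c_def algebra_simps diff_divide_distrib flip: w_aligns)
  ultimately have "(cmod (h u) - Re (h u)) / s \<le> 0"
    by simp
  then have "cmod (h u) = Re (h u)"
    using s_pos complex_Re_le_cmod[of "h u"] by (simp add: divide_le_0_iff)
  then show ?thesis
    using cmod_power2[of "h u"] by (simp add: complex_eq_iff)
qed

text \<open>Expand \<open>\<langle>x - Hx, H(x - Hx)\<rangle> \<ge> 0\<close> and bound \<open>\<langle>Hx, H(Hx)\<rangle>\<close> by \<open>\<parallel>Hx\<parallel>\<^sup>2\<close>.\<close>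

lemma positive_contraction_sqnorm_le:
  assumes form_nonneg: "\<And>x. inner_on A x (app_on A H x) = of_real (cmod (inner_on A x (app_on A H x)))"
    and H_contraction: "contraction_on A H"
  shows "sqnorm_on A (app_on A H x) \<le> Re (inner_on A x (app_on A H x))"
proof -
  define B where "B x y = inner_on A x (app_on A H y)" for x y
  define y where "y = app_on A H x"
  have B_nonneg: "Im (B z z) = 0" "0 \<le> Re (B z z)" for z
    using form_nonneg[of z] by (simp_all add: B_def complex_eq_iff)
  have B_combination: "B (\<lambda>i. x i + c * y i) (\<lambda>i. x i + c * y i)
      = B x x + c * B x y + cnj c * B y x + cnj c * c * B y y" for c
    by (simp add: B_def app_on_add app_on_scale inner_on_linear algebra_simps)
  have "Re (B x y) = Re (B y x)"
    using B_nonneg(1)[of "\<lambda>i. x i + \<i> * y i"] B_nonneg(1)[of x] B_nonneg(1)[of y] by (simp add: B_combination)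
  moreover have "0 \<le> Re (B x x) - Re (B x y) - Re (B y x) + Re (B y y)"
    using B_nonneg(2)[of "\<lambda>i. x i + (- 1) * y i"] unfolding B_combination by simp
  moreover have "Re (B y x) = sqnorm_on A y"
    by (simp add: B_def y_def[symmetric] inner_on_self)
  moreover have "Re (B y y) \<le> sqnorm_on A y"
  proof -
    have "sqnorm_on A (app_on A H y) \<le> sqnorm_on A y"
      using H_contraction by (simp add: contraction_on_def)
    then show ?thesis
      using Re_inner_on_le[of A y "app_on A H y"] by (simp add: B_def)
  qed
  ultimately show ?thesis
    by (simp add: B_def y_def)
qed

lemma sqnorm_on_adj_mult_on:
  assumes finite_A: "finite A" and V_orthonormal: "orthonormal_on A A V"
  shows "sqnorm_on A (app_on A (adj_mult_on A V M) x) = sqnorm_on A (app_on A M x)"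
proof -
  let ?W = "\<lambda>i j. cnj (V j i)"
  have "app_on A (adj_mult_on A V M) x = app_on A ?W (app_on A M x)"
    unfolding app_on_def adj_mult_on_def inner_on_def sum_distrib_left sum_distrib_right
    by (subst sum.swap) (simp add: mult.assoc)
  moreover have "orthonormal_on A A (\<lambda>j i. ?W i j)"
    using V_orthonormal by (simp add: orthonormal_on_def inner_on_cnj)
  ultimately have "complex_of_real (sqnorm_on A (app_on A (adj_mult_on A V M) x))
      = complex_of_real (sqnorm_on A (app_on A M x))"
    using inner_on_isometry[OF finite_A, of ?W] by (simp only: inner_on_self[symmetric])
  then show ?thesis
    by (simp only: of_real_eq_iff)
qed

lemma contraction_aligned_unitary:
  assumes finite_A: "finite A" and M_contraction: "contraction_on A M"
  shows "\<exists>V. orthonormal_on A A V \<and> hs_sqnorm_on A M \<le> Re (hs_inner_on A V M)"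
proof -
  obtain V where V_maximal: "maximally_aligned A M V"
    using maximally_aligned_exists[OF finite_A] by blast
  then have V_orthonormal: "orthonormal_on A A V"
    by (simp add: maximally_aligned_def)
  define H where "H = adj_mult_on A V M"
  have norm_H: "sqnorm_on A (app_on A H x) = sqnorm_on A (app_on A M x)" for x
    unfolding H_def by (rule sqnorm_on_adj_mult_on[OF finite_A V_orthonormal])
  then have "contraction_on A H"
    using M_contraction by (simp add: contraction_on_def)
  then have form_ge: "sqnorm_on A (app_on A M x) \<le> Re (inner_on A x (app_on A H x))" for x
    using positive_contraction_sqnorm_le[of A H x] maximally_aligned_form_nonneg[OF finite_A V_maximal]
    by (simp add: norm_H) (simp add: H_def inner_on_adj_mult_on)
  have column_le: "sqnorm_on A (\<lambda>i. M i j) \<le> Re (H j j)" if "j \<in> A" for j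
    using form_ge[of "\<lambda>l. of_bool (l = j)"] finite_A that by (simp add: app_on_unit inner_on_unit_left)
  have "hs_sqnorm_on A M = (\<Sum>j\<in>A. sqnorm_on A (\<lambda>i. M i j))"
    unfolding hs_sqnorm_on_def sqnorm_on_def by (rule sum.swap)
  also have "\<dots> \<le> (\<Sum>j\<in>A. Re (H j j))"
    by (intro sum_mono column_le)
  also have "\<dots> = Re (hs_inner_on A V M)"
    by (simp add: hs_inner_on_eq_trace H_def)
  finally show ?thesis
    using V_orthonormal by blast
qed

section \<open>Pauli coefficients and partial traces\<close>

definition walsh :: "'q set \<Rightarrow> 'q set \<Rightarrow> complex" where
  "walsh B Y = (-1) ^ card (B \<inter> Y)"

lemma walsh_commute: "walsh B Y = walsh Y B"
  by (simp add: walsh_def Int_commute)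

lemma cnj_walsh [simp]: "cnj (walsh B Y) = walsh B Y"
  by (simp add: walsh_def)

lemma walsh_eq_prod: "finite B \<Longrightarrow> walsh B Y = (\<Prod>j\<in>B. if j \<in> Y then -1 else 1)"
  by (simp add: walsh_def prod.If_cases)

lemma walsh_orthogonal:
  assumes subsets: "finite T" "X \<subseteq> T" "Y \<subseteq> T"
  shows "(\<Sum>B\<in>Pow T. walsh B X * walsh B Y) = of_bool (X = Y) * 2 ^ card T"
proof -
  let ?g = "\<lambda>j. (if j \<in> X then -1 else 1) * (if j \<in> Y then -1 else 1) :: complex"
  have "(\<Sum>B\<in>Pow T. walsh B X * walsh B Y) = (\<Sum>B\<in>Pow T. (\<Prod>j\<in>B. ?g j) * (\<Prod>j\<in>T-B. 1))"
    using finite_subset[OF _ subsets(1)] by (intro sum.cong refl) (auto simp: walsh_eq_prod prod.distrib)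
  also have "\<dots> = (\<Prod>j\<in>T. ?g j + 1)"
    by (rule prod_add[OF subsets(1), symmetric])
  also have "\<dots> = (\<Prod>j\<in>T. if j \<in> X \<longleftrightarrow> j \<in> Y then 2 else 0)"
    by (rule prod.cong) auto
  also have "\<dots> = of_bool (X = Y) * 2 ^ card T"
  proof (cases "X = Y")
    case False
    then have "\<exists>j\<in>T. \<not> (j \<in> X \<longleftrightarrow> j \<in> Y)"
      using subsets by blast
    then show ?thesis
      using False subsets(1) by (auto simp: prod_zero_iff)
  qed simp
  finally show ?thesis .
qed

text \<open>Matrices on a set of qubits are indexed by sets: \<open>Y\<close> stands for the basis state whose ones are at
  the positions in \<open>Y\<close>. Thus \<open>pauli a b\<close> is the operator \<open>X\<^sup>aZ\<^sup>b\<close>.\<close>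

definition pauli :: "'q set \<Rightarrow> 'q set \<Rightarrow> 'q set \<Rightarrow> 'q set \<Rightarrow> complex" where
  "pauli a b X Y = of_bool (X = sym_diff a Y) * walsh b Y"

definition pauli_coeff :: "'q set \<Rightarrow> ('q set \<Rightarrow> 'q set \<Rightarrow> complex) \<Rightarrow> 'q set \<Rightarrow> 'q set \<Rightarrow> complex" where
  "pauli_coeff S u a b = hs_inner_on (Pow S) (pauli a b) u / 2 ^ card S"

definition pauli_weight :: "'q set \<Rightarrow> ('q set \<Rightarrow> 'q set \<Rightarrow> complex) \<Rightarrow> 'q set \<Rightarrow> real" where
  "pauli_weight S u T = (\<Sum>(a,b)\<in>Pow T \<times> Pow T. (cmod (pauli_coeff S u a b))\<^sup>2)"

definition partial_trace :: "'q set \<Rightarrow> 'q set \<Rightarrow> ('q set \<Rightarrow> 'q set \<Rightarrow> complex) \<Rightarrow> 'q set \<Rightarrow> 'q set \<Rightarrow> complex" where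
  "partial_trace S T u X Y = (\<Sum>Z\<in>Pow (S - T). u (X \<union> Z) (Y \<union> Z)) / card (Pow (S - T))"

definition tensor_id :: "'q set \<Rightarrow> ('q set \<Rightarrow> 'q set \<Rightarrow> complex) \<Rightarrow> 'q set \<Rightarrow> 'q set \<Rightarrow> complex" where
  "tensor_id T v X Y = of_bool (X - T = Y - T) * v (X \<inter> T) (Y \<inter> T)"

lemma sum_Pow_split:
  assumes "T \<subseteq> S"
  shows "(\<Sum>Y\<in>Pow S. f Y) = (\<Sum>Y\<in>Pow T. \<Sum>Z\<in>Pow (S - T). f (Y \<union> Z))"
proof -
  have "bij_betw (\<lambda>(Y,Z). Y \<union> Z) (Pow T \<times> Pow (S - T)) (Pow S)"
    by (rule bij_betw_byWitness[where f'="\<lambda>Y. (Y \<inter> T, Y - T)"]) (use assms in auto)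
  from sum.reindex_bij_betw[OF this, of f] show ?thesis
    by (simp add: sum.cartesian_product case_prod_unfold)
qed

lemma power_card_split:
  assumes "finite S" "T \<subseteq> S"
  shows "(2::'a::comm_semiring_1) ^ card S = 2 ^ card T * 2 ^ card (S - T)"
proof -
  have "card S = card T + card (S - T)"
    using assms by (metis card_Diff_subset card_mono finite_subset le_add_diff_inverse)
  then show ?thesis
    by (simp add: power_add)
qed

lemma hs_inner_on_pauli:
  assumes finite_S: "finite S" and a_subset: "a \<subseteq> S"
  shows "hs_inner_on (Pow S) (pauli a b) u = (\<Sum>Y\<in>Pow S. walsh b Y * u (sym_diff a Y) Y)"
proof -
  have "hs_inner_on (Pow S) (pauli a b) u
      = (\<Sum>Y\<in>Pow S. \<Sum>X\<in>Pow S. of_bool (X = sym_diff a Y) * (walsh b Y * u X Y))"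
    unfolding hs_inner_on_def inner_on_def pauli_def by (subst sum.swap) (simp add: mult.assoc)
  also have "\<dots> = (\<Sum>Y\<in>Pow S. walsh b Y * u (sym_diff a Y) Y)"
  proof (intro sum.cong refl)
    fix Y assume "Y \<in> Pow S"
    then have "Pow S \<inter> {X. X = sym_diff a Y} = {sym_diff a Y}"
      using a_subset by blast
    then show "(\<Sum>X\<in>Pow S. of_bool (X = sym_diff a Y) * (walsh b Y * u X Y)) = walsh b Y * u (sym_diff a Y) Y"
      using finite_S by simp
  qed
  finally show ?thesis .
qed

lemma pauli_orthogonal:
  assumes finite_S: "finite S" and subsets: "a \<subseteq> S" "b \<subseteq> S" "b' \<subseteq> S"
  shows "hs_inner_on (Pow S) (pauli a b) (pauli a' b') = 2 ^ card S * of_bool (a = a' \<and> b = b')"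
proof -
  have "sym_diff a Y = sym_diff a' Y \<longleftrightarrow> a = a'" for Y
    by blast
  then have "hs_inner_on (Pow S) (pauli a b) (pauli a' b')
      = of_bool (a = a') * (\<Sum>Y\<in>Pow S. walsh Y b * walsh Y b')"
    unfolding hs_inner_on_pauli[OF finite_S subsets(1)] sum_distrib_left
    by (intro sum.cong refl) (simp add: pauli_def walsh_commute)
  then show ?thesis
    using walsh_orthogonal[OF finite_S subsets(2,3)] by simp
qed

lemma pauli_expansion:
  assumes finite_S: "finite S" and subsets: "X \<subseteq> S" "Y \<subseteq> S"
  shows "(\<Sum>(a,b)\<in>Pow S \<times> Pow S. pauli_coeff S u a b * pauli a b X Y) = u X Y"
proof -
  let ?d = "sym_diff X Y"
  have diff_subset: "?d \<subseteq> S" and "Pow S \<inter> {a. a = ?d} = {?d}"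
    using subsets by blast+
  moreover have "pauli a b X Y = of_bool (a = ?d) * walsh b Y" for a b
    unfolding pauli_def by (rule arg_cong2[where f="(*)"]) auto
  ultimately have "(\<Sum>(a,b)\<in>Pow S \<times> Pow S. pauli_coeff S u a b * pauli a b X Y)
      = (\<Sum>b\<in>Pow S. pauli_coeff S u ?d b * walsh b Y)"
    using finite_S
    by (simp add: mult.left_commute[of _ "of_bool _"] flip: sum.cartesian_product sum_distrib_left)
  also have "\<dots> = (\<Sum>b\<in>Pow S. \<Sum>W\<in>Pow S. u (sym_diff ?d W) W * (walsh b W * walsh b Y)) / 2 ^ card S"
    unfolding pauli_coeff_def hs_inner_on_pauli[OF finite_S diff_subset] sum_divide_distrib sum_distrib_right
    by (simp add: mult_ac)
  also have "\<dots> = (\<Sum>W\<in>Pow S. u (sym_diff ?d W) W * (\<Sum>b\<in>Pow S. walsh b W * walsh b Y)) / 2 ^ card S"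
    by (subst sum.swap) (simp add: sum_distrib_left)
  also have "\<dots> = (\<Sum>W\<in>Pow S. u (sym_diff ?d W) W * of_bool (W = Y))"
    using walsh_orthogonal[OF finite_S _ subsets(2)] by (simp add: sum_divide_distrib)
  also have "\<dots> = u (sym_diff ?d Y) Y"
    using finite_S subsets by simp
  also have "sym_diff ?d Y = X"
    by blast
  finally show ?thesis .
qed

lemma pauli_parseval:
  assumes finite_S: "finite S"
  shows "pauli_weight S u S = hs_sqnorm_on (Pow S) u / 2 ^ card S"
proof -
  let ?c = "pauli_coeff S u" and ?I = "Pow S \<times> Pow S"
  have "hs_inner_on (Pow S) u u = hs_inner_on (Pow S) u (\<lambda>X Y. \<Sum>(a,b)\<in>?I. ?c a b * pauli a b X Y)"
    by (intro hs_inner_on_cong) (simp_all add: pauli_expansion[OF finite_S])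
  also have "\<dots> = (\<Sum>X\<in>Pow S. \<Sum>Y\<in>Pow S. \<Sum>(a,b)\<in>?I. ?c a b * (cnj (u X Y) * pauli a b X Y))"
    unfolding hs_inner_on_def inner_on_def sum_distrib_left case_prod_unfold by (simp add: mult_ac)
  also have "\<dots> = (\<Sum>(a,b)\<in>?I. ?c a b * hs_inner_on (Pow S) u (pauli a b))"
    unfolding hs_inner_on_def inner_on_def sum_distrib_left case_prod_unfold
    by (subst sum.swap) (subst sum.swap, rule refl)
  also have "\<dots> = (\<Sum>(a,b)\<in>?I. of_real ((cmod (?c a b))\<^sup>2) * 2 ^ card S)"
  proof (intro sum.cong refl, clarify)
    fix a b
    have "hs_inner_on (Pow S) u (pauli a b) = cnj (?c a b) * 2 ^ card S"
      by (simp add: pauli_coeff_def hs_inner_on_commute[of _ u])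
    then show "?c a b * hs_inner_on (Pow S) u (pauli a b) = of_real ((cmod (?c a b))\<^sup>2) * 2 ^ card S"
      by (simp only: complex_norm_square mult.assoc)
  qed
  also have "\<dots> = complex_of_real (pauli_weight S u S * 2 ^ card S)"
    by (simp add: pauli_weight_def sum_distrib_right case_prod_unfold)
  finally have "hs_sqnorm_on (Pow S) u = pauli_weight S u S * 2 ^ card S"
    unfolding hs_inner_on_self of_real_eq_iff .
  then show ?thesis
    by simp
qed

lemma pauli_coeff_partial_trace:
  assumes finite_S: "finite S" and T_subset: "T \<subseteq> S" and subsets: "a \<subseteq> T" "b \<subseteq> T"
  shows "pauli_coeff S u a b = pauli_coeff T (partial_trace S T u) a b"
proof -
  have finite_T: "finite T"
    using finite_S T_subset finite_subset by blast
  have "hs_inner_on (Pow S) (pauli a b) u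
    = (\<Sum>Y\<in>Pow T. \<Sum>Z\<in>Pow (S - T). walsh b (Y \<union> Z) * u (sym_diff a (Y \<union> Z)) (Y \<union> Z))"
    using finite_S T_subset subsets by (subst hs_inner_on_pauli) (auto intro: sum_Pow_split)
  also have "\<dots> = (\<Sum>Y\<in>Pow T. \<Sum>Z\<in>Pow (S - T). walsh b Y * u (sym_diff a Y \<union> Z) (Y \<union> Z))"
  proof (intro sum.cong refl)
    fix Y Z assume "Y \<in> Pow T" "Z \<in> Pow (S - T)"
    then have "sym_diff a (Y \<union> Z) = sym_diff a Y \<union> Z" and "b \<inter> (Y \<union> Z) = b \<inter> Y"
      using subsets by blast+
    then show "walsh b (Y \<union> Z) * u (sym_diff a (Y \<union> Z)) (Y \<union> Z) = walsh b Y * u (sym_diff a Y \<union> Z) (Y \<union> Z)"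
      by (simp add: walsh_def)
  qed
  also have "\<dots> = 2 ^ card (S - T) * hs_inner_on (Pow T) (pauli a b) (partial_trace S T u)"
    using finite_S unfolding hs_inner_on_pauli[OF finite_T subsets(1)] sum_distrib_left[of "2 ^ card (S - T)"]
    by (intro sum.cong refl) (simp add: partial_trace_def card_Pow flip: sum_distrib_left)
  finally show ?thesis
    by (simp add: pauli_coeff_def power_card_split[OF finite_S T_subset])
qed

lemma pauli_weight_partial_trace:
  assumes finite_S: "finite S" and T_subset: "T \<subseteq> S"
  shows "pauli_weight S u T = hs_sqnorm_on (Pow T) (partial_trace S T u) / 2 ^ card T"
proof -
  have "pauli_weight S u T = pauli_weight T (partial_trace S T u) T"
    unfolding pauli_weight_def
    by (intro sum.cong refl) (auto simp: pauli_coeff_partial_trace[OF finite_S T_subset])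
  also have "\<dots> = hs_sqnorm_on (Pow T) (partial_trace S T u) / 2 ^ card T"
    by (rule pauli_parseval[OF finite_subset[OF T_subset finite_S]])
  finally show ?thesis .
qed

lemma pauli_weight_mono:
  assumes "finite R" "T \<subseteq> R"
  shows "pauli_weight S u T \<le> pauli_weight S u R"
  unfolding pauli_weight_def using assms by (intro sum_mono2) auto

lemma partial_trace_contraction:
  assumes finite_S: "finite S" and T_subset: "T \<subseteq> S" and u_contraction: "contraction_on (Pow S) u"
  shows "contraction_on (Pow T) (partial_trace S T u)"
proof -
  have "contraction_on (Pow T) (\<lambda>X Y. u (X \<union> Z) (Y \<union> Z))" if "Z \<in> Pow (S - T)" for Z
  proof (rule contraction_on_compression[OF _ _ _ u_contraction])
    show "inj_on (\<lambda>X. X \<union> Z) (Pow T)"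
      by (rule inj_on_inverseI[where g="\<lambda>W. W \<inter> T"]) (use that in blast)
  qed (use finite_S T_subset that in auto)
  then show ?thesis
    unfolding partial_trace_def[abs_def] using finite_S by (intro contraction_on_average) auto
qed

lemma tensor_id_Un:
  assumes "X \<subseteq> T" "Y \<subseteq> T" "Z \<inter> T = {}" "Z' \<inter> T = {}"
  shows "tensor_id T v (X \<union> Z) (Y \<union> Z') = of_bool (Z = Z') * v X Y"
proof -
  have "X \<union> Z - T = Z" "Y \<union> Z' - T = Z'" "(X \<union> Z) \<inter> T = X" "(Y \<union> Z') \<inter> T = Y"
    using assms by blast+
  then show ?thesis
    by (simp add: tensor_id_def)
qed

lemma orthonormal_on_tensor_id:
  assumes finite_S: "finite S" and T_subset: "T \<subseteq> S" and v_orthonormal: "orthonormal_on (Pow T) (Pow T) v"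
  shows "orthonormal_on (Pow S) (Pow S) (tensor_id T v)"
  unfolding orthonormal_on_def
proof (intro ballI)
  fix X Y assume "X \<in> Pow S" "Y \<in> Pow S"
  define X1 X2 Y1 Y2 where "X1 = X \<inter> T" and "X2 = X - T" and "Y1 = Y \<inter> T" and "Y2 = Y - T"
  have split: "X = X1 \<union> X2" "Y = Y1 \<union> Y2"
    and part_subsets: "X1 \<subseteq> T" "X2 \<subseteq> S - T" "Y1 \<subseteq> T" "Y2 \<subseteq> S - T"
    and eq_iff_parts: "X = Y \<longleftrightarrow> X1 = Y1 \<and> X2 = Y2"
    using \<open>X \<in> Pow S\<close> \<open>Y \<in> Pow S\<close> unfolding X1_def X2_def Y1_def Y2_def by blast+
  have "inner_on (Pow S) (tensor_id T v X) (tensor_id T v Y)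
      = (\<Sum>W\<in>Pow T. \<Sum>Z\<in>Pow (S - T). of_bool (X2 = Z) * (of_bool (Y2 = X2) * (cnj (v X1 W) * v Y1 W)))"
    unfolding inner_on_def sum_Pow_split[OF T_subset] split
  proof (intro sum.cong refl)
    fix W Z assume subsets: "W \<in> Pow T" "Z \<in> Pow (S - T)"
    then have "X2 \<inter> T = {}" "Y2 \<inter> T = {}" "Z \<inter> T = {}"
      using part_subsets by blast+
    then have "tensor_id T v (X1 \<union> X2) (W \<union> Z) = of_bool (X2 = Z) * v X1 W"
      and "tensor_id T v (Y1 \<union> Y2) (W \<union> Z) = of_bool (Y2 = Z) * v Y1 W"
      using subsets part_subsets by (simp_all add: tensor_id_Un)
    then show "cnj (tensor_id T v (X1 \<union> X2) (W \<union> Z)) * tensor_id T v (Y1 \<union> Y2) (W \<union> Z)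
        = of_bool (X2 = Z) * (of_bool (Y2 = X2) * (cnj (v X1 W) * v Y1 W))"
      by simp
  qed
  also have "\<dots> = of_bool (Y2 = X2) * inner_on (Pow T) (v X1) (v Y1)"
    using finite_S part_subsets by (simp add: inner_on_def sum_distrib_left)
  also have "\<dots> = of_bool (X = Y)"
    using v_orthonormal part_subsets by (auto simp: orthonormal_on_def eq_iff_parts)
  finally show "inner_on (Pow S) (tensor_id T v X) (tensor_id T v Y) = of_bool (X = Y)" .
qed

lemma partial_trace_tensor_id:
  assumes "finite S" "T \<subseteq> S" "X \<subseteq> T" "Y \<subseteq> T"
  shows "partial_trace S T (tensor_id T v) X Y = v X Y"
proof -
  have "(\<Sum>Z\<in>Pow (S - T). tensor_id T v (X \<union> Z) (Y \<union> Z)) = (\<Sum>Z\<in>Pow (S - T). v X Y)"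
    using assms by (intro sum.cong refl, subst tensor_id_Un) auto
  then show ?thesis
    using assms by (simp add: partial_trace_def card_Pow)
qed

lemma hs_inner_on_tensor_id:
  assumes finite_S: "finite S" and T_subset: "T \<subseteq> S"
  shows "hs_inner_on (Pow S) (tensor_id T v) u
    = 2 ^ card (S - T) * hs_inner_on (Pow T) v (partial_trace S T u)"
proof -
  let ?R = "Pow (S - T)"
  have "hs_inner_on (Pow S) (tensor_id T v) u
      = (\<Sum>X\<in>Pow T. \<Sum>Z\<in>?R. \<Sum>Y\<in>Pow T. \<Sum>Z'\<in>?R. of_bool (Z = Z') * (cnj (v X Y) * u (X \<union> Z) (Y \<union> Z')))"
    unfolding hs_inner_on_def inner_on_def sum_Pow_split[OF T_subset]
    by (intro sum.cong refl, subst tensor_id_Un) auto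
  also have "\<dots> = (\<Sum>X\<in>Pow T. \<Sum>Z\<in>?R. \<Sum>Y\<in>Pow T. cnj (v X Y) * u (X \<union> Z) (Y \<union> Z))"
    using finite_S by (intro sum.cong refl) simp
  also have "\<dots> = (\<Sum>X\<in>Pow T. \<Sum>Y\<in>Pow T. cnj (v X Y) * (\<Sum>Z\<in>?R. u (X \<union> Z) (Y \<union> Z)))"
    unfolding sum_distrib_left by (rule sum.cong[OF refl sum.swap])
  also have "\<dots> = 2 ^ card (S - T) * hs_inner_on (Pow T) v (partial_trace S T u)"
    using finite_S unfolding hs_inner_on_def inner_on_def sum_distrib_left[of "2 ^ card (S - T)" _ "Pow T"]
    by (intro sum.cong refl) (simp add: partial_trace_def card_Pow)
  finally show ?thesis .
qed

lemma pauli_weight_rounding: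
  assumes finite_S: "finite S" and T_subset: "T \<subseteq> S" and u_contraction: "contraction_on (Pow S) u"
  shows "\<exists>v. orthonormal_on (Pow T) (Pow T) v \<and>
    pauli_weight S u T \<le> Re (hs_inner_on (Pow S) (tensor_id T v) u) / 2 ^ card S"
proof -
  have "finite (Pow T)"
    using finite_subset[OF T_subset finite_S] by simp
  then obtain v where v_orthonormal: "orthonormal_on (Pow T) (Pow T) v"
    and sqnorm_le: "hs_sqnorm_on (Pow T) (partial_trace S T u)
      \<le> Re (hs_inner_on (Pow T) v (partial_trace S T u))"
    using contraction_aligned_unitary partial_trace_contraction[OF finite_S T_subset u_contraction] by blast
  have Re_divide_power2: "Re (z / 2 ^ m) = Re z / 2 ^ m" for z m
    using Re_divide_of_real[of z "2 ^ m"] by simp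
  have "pauli_weight S u T \<le> Re (hs_inner_on (Pow T) v (partial_trace S T u)) / 2 ^ card T"
    unfolding pauli_weight_partial_trace[OF finite_S T_subset] by (intro divide_right_mono sqnorm_le) simp
  also have "\<dots> = Re (hs_inner_on (Pow S) (tensor_id T v) u) / 2 ^ card S"
    unfolding Re_divide_power2[symmetric] hs_inner_on_tensor_id[OF finite_S T_subset]
      power_card_split[OF finite_S T_subset] by simp
  finally show ?thesis
    using v_orthonormal by blast
qed

section \<open>Unitary matrices and the phase-invariant distance\<close>

abbreviation entries :: "complex mat \<Rightarrow> nat \<Rightarrow> nat \<Rightarrow> complex" where
  "entries U \<equiv> \<lambda>i j. U $$ (i,j)"

lemma adj_index [simp]:
  "i < dim_col A \<Longrightarrow> j < dim_row A \<Longrightarrow> adj A $$ (i,j) = cnj (A $$ (j,i))"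
  by (simp add: adj_def)

lemma adj_dim [simp]: "dim_row (adj A) = dim_col A" "dim_col (adj A) = dim_row A"
  by (simp_all add: adj_def)

lemma adj_carrier [simp]: "A \<in> carrier_mat m n \<Longrightarrow> adj A \<in> carrier_mat n m"
  by (auto simp: adj_def)

lemma unitary_mat_iff_orthonormal_cols:
  "unitary_mat d U \<longleftrightarrow> U \<in> carrier_mat d d \<and> orthonormal_on {..<d} {..<d} (\<lambda>j i. U $$ (i,j))"
proof -
  have "adj U * U = 1\<^sub>m d \<longleftrightarrow> orthonormal_on {..<d} {..<d} (\<lambda>j i. U $$ (i,j))"
    if U_carrier: "U \<in> carrier_mat d d"
  proof -
    have "(adj U * U) $$ (i,j) = inner_on {..<d} (\<lambda>x. U $$ (x,i)) (\<lambda>x. U $$ (x,j))" if "i < d" "j < d" for i j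
      using U_carrier that by (auto simp: inner_on_def scalar_prod_def atLeast0LessThan intro!: sum.cong)
    then show ?thesis
      using U_carrier by (auto simp: mat_eq_iff orthonormal_on_def)
  qed
  then show ?thesis
    by (auto simp: unitary_mat_def)
qed

lemma unitary_mat_if_orthonormal_rows:
  assumes U_carrier: "U \<in> carrier_mat d d" and rows_orthonormal: "orthonormal_on {..<d} {..<d} (entries U)"
  shows "unitary_mat d U"
proof -
  have "(U * adj U) $$ (i,j) = inner_on {..<d} (entries U j) (entries U i)" if "i < d" "j < d" for i j
    using U_carrier that
    by (auto simp: inner_on_def scalar_prod_def atLeast0LessThan mult.commute intro!: sum.cong)
  then have "U * adj U = 1\<^sub>m d"
    using U_carrier rows_orthonormal by (auto simp: mat_eq_iff orthonormal_on_def)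
  then have "adj U * U = 1\<^sub>m d"
    using U_carrier mat_mult_left_right_inverse adj_carrier by blast
  then show ?thesis
    using U_carrier by (simp add: unitary_mat_def)
qed

lemma hs_sqnorm_on_unitary_mat: "unitary_mat d U \<Longrightarrow> hs_sqnorm_on {..<d} (entries U) = d"
  by (simp add: unitary_mat_iff_orthonormal_cols hs_sqnorm_on_orthonormal)

lemma unitary_mat_realization:
  assumes f_bij: "bij_betw f A {..<d}" and V_orthonormal: "orthonormal_on A A V"
  shows "\<exists>U. unitary_mat d U \<and> (\<forall>i\<in>A. \<forall>j\<in>A. U $$ (f i, f j) = V i j)"
proof -
  define U where "U = mat d d (\<lambda>(x,y). V (the_inv_into A f x) (the_inv_into A f y))"
  have entry: "U $$ (f i, f j) = V i j" if "i \<in> A" "j \<in> A" for i j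
    using f_bij bij_betw_apply[OF f_bij] that by (simp add: U_def bij_betw_def the_inv_into_f_f)
  have "orthonormal_on A A (\<lambda>i j. U $$ (f i, f j))"
    using V_orthonormal by (subst orthonormal_on_cong[of _ _ _ V]) (simp_all add: entry)
  then have "unitary_mat d U"
    by (intro unitary_mat_if_orthonormal_rows) (simp_all add: U_def orthonormal_on_reindex[OF f_bij])
  then show ?thesis
    using entry by blast
qed

lemma exists_phase_cmod: "\<exists>\<theta>\<in>{0..<2*pi}. exp (\<i> * complex_of_real \<theta>) * z = complex_of_real (cmod z)"
proof
  let ?e = "exp (\<i> * complex_of_real (Arg2pi (cnj z)))"
  show "Arg2pi (cnj z) \<in> {0..<2*pi}"
    using Arg2pi[of "cnj z"] by simp
  have "cnj z = cmod z * ?e"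
    using Arg2pi_eq[of "cnj z"] by simp
  then have "?e * z = cmod z * (?e * cnj ?e)"
    by (metis complex_cnj_cnj complex_cnj_complex_of_real complex_cnj_mult mult.left_commute)
  also have "?e * cnj ?e = 1"
    by (simp flip: complex_norm_square)
  finally show "?e * z = complex_of_real (cmod z)"
    by simp
qed

lemma hs_norm_eq: "A \<in> carrier_mat N N \<Longrightarrow> hs_norm A = sqrt (hs_sqnorm_on {..<N} (entries A))"
  by (auto simp: hs_norm_def hs_sqnorm_on_def sqnorm_on_def)

lemma dist_ph_le:
  assumes U_unitary: "unitary_mat N U" and V_unitary: "unitary_mat N V" and N_pos: "N \<ge> 1"
  shows "dist_ph N U V \<le> sqrt (1 - cmod (hs_inner_on {..<N} (entries V) (entries U)) / N)"
proof -
  let ?S = "{..<N}" and ?z = "hs_inner_on {..<N} (entries V) (entries U)"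
  obtain \<theta> where \<theta>_range: "\<theta> \<in> {0..<2*pi}" and "exp (\<i> * complex_of_real \<theta>) * ?z = cmod ?z"
    using exists_phase_cmod by blast
  define e where "e = exp (\<i> * complex_of_real \<theta>)"
  have e_phase: "cmod e = 1" "e * ?z = cmod ?z"
    using \<open>exp _ * _ = _\<close> by (simp_all add: e_def)
  have carriers: "U \<in> carrier_mat N N" "V \<in> carrier_mat N N"
    using U_unitary V_unitary by (simp_all add: unitary_mat_def)
  have "hs_sqnorm_on ?S (entries (e \<cdot>\<^sub>m U - V)) = hs_sqnorm_on ?S (\<lambda>i j. e * U $$ (i,j) - V $$ (i,j))"
    unfolding hs_sqnorm_on_def sqnorm_on_def using carriers by (intro sum.cong refl) auto
  also have "\<dots> = hs_sqnorm_on ?S (\<lambda>i j. e * U $$ (i,j)) + N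
      - 2 * Re (hs_inner_on ?S (entries V) (\<lambda>i j. e * U $$ (i,j)))"
    by (simp add: hs_sqnorm_on_diff hs_sqnorm_on_unitary_mat[OF V_unitary])
  also have "hs_sqnorm_on ?S (\<lambda>i j. e * U $$ (i,j)) = N"
    unfolding hs_sqnorm_on_unitary_mat[OF U_unitary, symmetric]
    by (simp add: hs_sqnorm_on_def sqnorm_on_def norm_mult e_phase)
  also have "hs_inner_on ?S (entries V) (\<lambda>i j. e * U $$ (i,j)) = cmod ?z"
    unfolding e_phase(2)[symmetric] by (simp add: hs_inner_on_def inner_on_scale_right sum_distrib_left)
  finally have "hs_norm (e \<cdot>\<^sub>m U - V) = sqrt (2 * N - 2 * cmod ?z)"
    using hs_norm_eq[of "e \<cdot>\<^sub>m U - V" N] carriers by (simp add: minus_carrier_mat)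
  then have "hs_norm (e \<cdot>\<^sub>m U - V) / sqrt (2 * real N) = sqrt (1 - cmod ?z / N)"
    using N_pos by (simp add: real_sqrt_divide[symmetric] diff_divide_distrib)
  moreover have "dist_ph N U V \<le> hs_norm (e \<cdot>\<^sub>m U - V) / sqrt (2 * real N)"
    unfolding dist_ph_def e_def
    by (rule cINF_lower[OF _ \<theta>_range]) (auto intro!: bdd_belowI[of _ 0] simp: hs_norm_def sum_nonneg)
  ultimately show ?thesis
    by simp
qed

lemma eps_far_overlap_le:
  assumes far: "eps_far N S \<epsilon> U" and V_member: "V \<in> S" "unitary_mat N V" and U_unitary: "unitary_mat N U"
    and "N \<ge> 1" "\<epsilon> > 0"
  shows "\<epsilon>\<^sup>2 \<le> 1 - cmod (hs_inner_on {..<N} (entries V) (entries U)) / N"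
proof -
  let ?r = "1 - cmod (hs_inner_on {..<N} (entries V) (entries U)) / N"
  have "\<epsilon> \<le> dist_ph N U V"
    using far V_member(1) by (simp add: eps_far_def)
  then have \<epsilon>_le_sqrt: "\<epsilon> \<le> sqrt ?r"
    using dist_ph_le[OF U_unitary V_member(2) \<open>N \<ge> 1\<close>] by linarith
  then have "?r > 0"
    using \<open>\<epsilon> > 0\<close> by (metis less_le_trans real_sqrt_gt_0_iff)
  then show ?thesis
    using power_mono[OF \<epsilon>_le_sqrt, of 2] \<open>\<epsilon> > 0\<close> by simp
qed

section \<open>Juntas as matrices indexed by sets of qubits\<close>

lemma set_encode_less:
  assumes "A \<subseteq> {..<n}"
  shows "set_encode A < 2 ^ n"
proof -
  have "set_encode A \<le> (\<Sum>i<n. 2 ^ i)"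
    unfolding set_encode_def using assms by (intro sum_mono2) auto
  also have "\<dots> < 2 ^ n"
    by (induction n) auto
  finally show ?thesis .
qed

lemma set_decode_subset:
  assumes "x < 2 ^ n"
  shows "set_decode x \<subseteq> {..<n}"
proof
  fix i assume "i \<in> set_decode x"
  then have "\<not> x < 2 ^ i"
    by (auto simp: set_decode_def)
  with assms have "(2::nat) ^ i < 2 ^ n"
    by linarith
  then show "i \<in> {..<n}"
    by (simp add: power_strict_increasing_iff)
qed

lemma set_decode_set_encode: "X \<subseteq> {..<n} \<Longrightarrow> set_decode (set_encode X) = X"
  using finite_subset[of X "{..<n}"] by simp

lemma bij_betw_set_encode: "bij_betw set_encode (Pow {..<n}) {..<2 ^ n}"
  by (rule bij_betw_byWitness[where f'=set_decode])
    (auto simp: set_encode_less set_decode_set_encode dest: set_decode_subset)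

lemma bij_betw_set_decode: "bij_betw set_decode {..<2 ^ n} (Pow {..<n})"
  by (rule bij_betw_byWitness[where f'=set_encode])
    (auto simp: set_encode_less set_decode_set_encode dest: set_decode_subset)

lemma qbit_set_encode: "finite X \<Longrightarrow> qbit (set_encode X) j \<longleftrightarrow> j \<in> X"
  using set_encode_inverse[of X] by (auto simp: qbit_def set_decode_def)

lemma sub_index_set_encode_Int:
  assumes "finite X" "finite T"
  shows "sub_index T (set_encode (X \<inter> T)) = sub_index T (set_encode X)"
proof -
  have "sorted_list_of_set T ! i \<in> T" if "i < card T" for i
    using assms that
    by (metis nth_mem set_sorted_list_of_set sorted_list_of_set.length_sorted_key_list_of_set)
  then show ?thesis
    using assms by (simp add: sub_index_def qbit_set_encode)
qed

lemma bij_betw_sub_index: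
  assumes finite_T: "finite T"
  shows "bij_betw (\<lambda>X. sub_index T (set_encode X)) (Pow T) {..<2 ^ card T}"
proof -
  let ?xs = "sorted_list_of_set T" and ?k = "card T"
  have nth_bij: "bij_betw ((!) ?xs) {..<?k} T"
    using finite_T by (intro bij_betw_nth) auto
  have "bij_betw (\<lambda>X. {i. i < ?k \<and> ?xs ! i \<in> X}) (Pow T) (Pow {..<?k})"
  proof (rule bij_betw_byWitness[where f'="\<lambda>I. (!) ?xs ` I"])
    show "\<forall>X\<in>Pow T. (!) ?xs ` {i. i < ?k \<and> ?xs ! i \<in> X} = X"
      using bij_betw_imp_surj_on[OF nth_bij] by (auto simp: image_iff)
    show "\<forall>I\<in>Pow {..<?k}. {i. i < ?k \<and> ?xs ! i \<in> (!) ?xs ` I} = I"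
      using bij_betw_imp_inj_on[OF nth_bij] by (auto simp: inj_on_def)
    show "(\<lambda>I. (!) ?xs ` I) ` Pow {..<?k} \<subseteq> Pow T"
      using bij_betw_imp_surj_on[OF nth_bij] by blast
  qed auto
  then have encode_bij: "bij_betw (set_encode \<circ> (\<lambda>X. {i. i < ?k \<and> ?xs ! i \<in> X})) (Pow T) {..<2 ^ ?k}"
    using bij_betw_set_encode by (rule bij_betw_trans)
  have encode_eq_sub_index: "(set_encode \<circ> (\<lambda>X. {i. i < ?k \<and> ?xs ! i \<in> X})) X = sub_index T (set_encode X)"
    if X_subset: "X \<in> Pow T" for X
  proof -
    have "finite X"
      using X_subset finite_T finite_subset by auto
    moreover have "{i. i < ?k \<and> ?xs ! i \<in> X} = {..<?k} \<inter> {i. ?xs ! i \<in> X}"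
      by auto
    ultimately show ?thesis
      by (simp add: sub_index_def qbit_set_encode) (simp add: set_encode_def sum.inter_restrict)
  qed
  show ?thesis
    by (rule iffD1[OF bij_betw_cong encode_bij]) (rule encode_eq_sub_index)
qed

definition set_entry :: "complex mat \<Rightarrow> nat set \<Rightarrow> nat set \<Rightarrow> complex" where
  "set_entry U X Y = U $$ (set_encode X, set_encode Y)"

definition sub_entry :: "nat set \<Rightarrow> complex mat \<Rightarrow> nat set \<Rightarrow> nat set \<Rightarrow> complex" where
  "sub_entry T V X Y = V $$ (sub_index T (set_encode X), sub_index T (set_encode Y))"

lemma set_entry_embed_op:
  assumes "T \<subseteq> {..<n}" and X_subset: "X \<subseteq> {..<n}" and Y_subset: "Y \<subseteq> {..<n}"
  shows "set_entry (embed_op n T V) X Y = tensor_id T (sub_entry T V) X Y"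
proof -
  have finite_sets: "finite X" "finite Y" "finite T"
    using assms finite_subset by blast+
  have "(\<forall>j<n. j \<notin> T \<longrightarrow> qbit (set_encode X) j = qbit (set_encode Y) j) \<longleftrightarrow> X - T = Y - T"
    using X_subset Y_subset finite_sets by (auto simp: qbit_set_encode)
  then show ?thesis
    using X_subset Y_subset finite_sets
    by (simp add: set_entry_def embed_op_def tensor_id_def sub_entry_def set_encode_less
        sub_index_set_encode_Int)
qed

lemma hs_inner_on_entries:
  "hs_inner_on {..<2 ^ n} (entries U) (entries V) = hs_inner_on (Pow {..<n}) (set_entry U) (set_entry V)"
  unfolding hs_inner_on_reindex[OF bij_betw_set_encode] set_entry_def[abs_def] ..

lemma orthonormal_on_set_entry:
  assumes "unitary_mat (2 ^ n) U"
  shows "orthonormal_on (Pow {..<n}) (Pow {..<n}) (\<lambda>Y X. set_entry U X Y)"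
  using assms unfolding unitary_mat_iff_orthonormal_cols
  by (simp add: orthonormal_on_reindex[OF bij_betw_set_encode] set_entry_def)

lemma pauli_weight_unitary:
  assumes "unitary_mat (2 ^ n) U"
  shows "pauli_weight {..<n} (set_entry U) {..<n} = 1"
  using orthonormal_on_set_entry[OF assms]
  by (simp add: pauli_parseval hs_sqnorm_on_orthonormal card_Pow)

lemma has_property_pauli_weight:
  assumes "has_property (juntas n k) U"
  shows "\<exists>T. T \<subseteq> {..<n} \<and> card T = k \<and> pauli_weight {..<n} (set_entry U) T = 1"
proof -
  obtain \<theta> T V where T_qubits: "T \<subseteq> {..<n}" "card T = k" and V_unitary: "unitary_mat (2 ^ k) V"
    and U_eq: "U = exp (\<i> * complex_of_real \<theta>) \<cdot>\<^sub>m embed_op n T V"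
    using assms by (auto simp: has_property_def juntas_def)
  let ?u = "set_entry U" and ?v = "sub_entry T V" and ?e = "exp (\<i> * complex_of_real \<theta>)"
  have finite_T: "finite T"
    using T_qubits finite_subset by blast
  have entry: "?u X Y = tensor_id T (\<lambda>X Y. ?e * ?v X Y) X Y" if "X \<subseteq> {..<n}" "Y \<subseteq> {..<n}" for X Y
    using set_entry_embed_op[OF T_qubits(1) that, of V] that
    by (simp add: U_eq set_entry_def embed_op_def set_encode_less tensor_id_def)
  have "partial_trace {..<n} T ?u X Y = ?e * ?v X Y" if subsets: "X \<subseteq> T" "Y \<subseteq> T" for X Y
  proof -
    have "partial_trace {..<n} T ?u X Y = partial_trace {..<n} T (tensor_id T (\<lambda>X Y. ?e * ?v X Y)) X Y"
      unfolding partial_trace_def using T_qubits subsets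
      by (intro arg_cong2[where f="(/)"] sum.cong refl entry) auto
    then show ?thesis
      using T_qubits subsets by (simp add: partial_trace_tensor_id)
  qed
  then have "hs_sqnorm_on (Pow T) (partial_trace {..<n} T ?u) = hs_sqnorm_on (Pow T) ?v"
    by (simp add: hs_sqnorm_on_def sqnorm_on_def norm_mult)
  also have "\<dots> = hs_sqnorm_on {..<2 ^ card T} (entries V)"
    unfolding hs_sqnorm_on_reindex[OF bij_betw_sub_index[OF finite_T]] sub_entry_def[abs_def] ..
  also have "\<dots> = 2 ^ card T"
    using V_unitary T_qubits by (simp add: hs_sqnorm_on_unitary_mat)
  finally show ?thesis
    using T_qubits by (auto simp: pauli_weight_partial_trace intro!: exI[of _ T])
qed

lemma junta_realization:
  assumes T_subset: "T \<subseteq> {..<n}" and v_orthonormal: "orthonormal_on (Pow T) (Pow T) v"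
  shows "\<exists>J\<in>juntas n (card T). unitary_mat (2 ^ n) J \<and>
    (\<forall>X\<in>Pow {..<n}. \<forall>Y\<in>Pow {..<n}. set_entry J X Y = tensor_id T v X Y)"
proof -
  have "finite T"
    using T_subset finite_subset by blast
  then obtain V where V_unitary: "unitary_mat (2 ^ card T) V"
    and V_entry: "\<And>X Y. X \<subseteq> T \<Longrightarrow> Y \<subseteq> T \<Longrightarrow> sub_entry T V X Y = v X Y"
    using unitary_mat_realization[OF bij_betw_sub_index v_orthonormal] unfolding sub_entry_def by blast
  let ?J = "embed_op n T V"
  have entry: "set_entry ?J X Y = tensor_id T v X Y" if "X \<in> Pow {..<n}" "Y \<in> Pow {..<n}" for X Y
    using set_entry_embed_op[OF T_subset, of X Y V] that by (simp add: tensor_id_def V_entry)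
  have "orthonormal_on (Pow {..<n}) (Pow {..<n}) (set_entry ?J)"
    using orthonormal_on_tensor_id[OF _ T_subset v_orthonormal]
    by (subst orthonormal_on_cong[of _ _ _ "tensor_id T v"]) (simp_all add: entry)
  then have "unitary_mat (2 ^ n) ?J"
    by (intro unitary_mat_if_orthonormal_rows)
      (simp_all add: embed_op_def orthonormal_on_reindex[OF bij_betw_set_encode] set_entry_def[abs_def])
  moreover have "?J \<in> juntas n (card T)"
    using T_subset V_unitary by (auto simp: juntas_def)
  ultimately show ?thesis
    using entry by blast
qed

lemma eps_far_juntas_overlap_le:
  assumes U_unitary: "unitary_mat (2 ^ n) U" and far: "eps_far (2 ^ n) (juntas n (card T)) \<epsilon> U"
    and \<epsilon>_pos: "\<epsilon> > 0" and T_subset: "T \<subseteq> {..<n}" and v_orthonormal: "orthonormal_on (Pow T) (Pow T) v"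
  shows "\<epsilon>\<^sup>2 \<le> 1 - cmod (hs_inner_on (Pow {..<n}) (tensor_id T v) (set_entry U)) / 2 ^ n"
proof -
  obtain J where J_junta: "J \<in> juntas n (card T)" "unitary_mat (2 ^ n) J"
    and entry: "\<And>X Y. X \<in> Pow {..<n} \<Longrightarrow> Y \<in> Pow {..<n} \<Longrightarrow> set_entry J X Y = tensor_id T v X Y"
    using junta_realization[OF T_subset v_orthonormal] by blast
  have "hs_inner_on {..<2 ^ n} (entries J) (entries U)
      = hs_inner_on (Pow {..<n}) (tensor_id T v) (set_entry U)"
    unfolding hs_inner_on_entries by (intro hs_inner_on_cong entry refl)
  then show ?thesis
    using eps_far_overlap_le[OF far J_junta U_unitary _ \<epsilon>_pos] by simp
qed

lemma eps_far_juntas_pauli_weight_le: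
  assumes U_unitary: "unitary_mat (2 ^ n) U" and far: "eps_far (2 ^ n) (juntas n k) \<epsilon> U" and \<epsilon>_pos: "\<epsilon> > 0"
    and T_small: "T \<subseteq> {..<n}" "card T \<le> k" and k_le_n: "k \<le> n"
  shows "pauli_weight {..<n} (set_entry U) T \<le> 1 - \<epsilon>\<^sup>2"
proof -
  obtain R where R_superset: "T \<subseteq> R" "R \<subseteq> {..<n}" "card R = k"
    using exists_subset_between[OF T_small(2) _ T_small(1)] k_le_n by auto
  have "contraction_on (Pow {..<n}) (set_entry U)"
    by (intro contraction_on_isometry orthonormal_on_set_entry U_unitary) simp
  then obtain v where v_orthonormal: "orthonormal_on (Pow R) (Pow R) v"
    and weight_R_le: "pauli_weight {..<n} (set_entry U) R
      \<le> Re (hs_inner_on (Pow {..<n}) (tensor_id R v) (set_entry U)) / 2 ^ n"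
    using pauli_weight_rounding[OF _ R_superset(2)] by auto
  have "pauli_weight {..<n} (set_entry U) T \<le> pauli_weight {..<n} (set_entry U) R"
    using R_superset finite_subset by (intro pauli_weight_mono) auto
  also note weight_R_le
  also have "Re (hs_inner_on (Pow {..<n}) (tensor_id R v) (set_entry U)) / 2 ^ n
      \<le> cmod (hs_inner_on (Pow {..<n}) (tensor_id R v) (set_entry U)) / 2 ^ n"
    by (intro divide_right_mono complex_Re_le_cmod) simp
  also have "\<dots> \<le> 1 - \<epsilon>\<^sup>2"
    using eps_far_juntas_overlap_le[OF U_unitary _ \<epsilon>_pos R_superset(2) v_orthonormal] far R_superset(3) by simp
  finally show ?thesis .
qed

section \<open>Unitary extension of orthonormal families\<close>

abbreviation vec_inner :: "nat \<Rightarrow> complex vec \<Rightarrow> complex vec \<Rightarrow> complex" where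
  "vec_inner D v w \<equiv> inner_on {..<D} (($) v) (($) w)"

lemma mult_mat_vec_nth:
  assumes "A \<in> carrier_mat n m" "v \<in> carrier_vec m" "i < n"
  shows "(A *\<^sub>v v) $ i = app_on {..<m} (entries A) (($) v) i"
  using assms by (auto simp: app_on_def scalar_prod_def atLeast0LessThan intro!: sum.cong)

lemma vec_inner_unitary:
  assumes W_unitary: "unitary_mat D W" and v_carrier: "v \<in> carrier_vec D" and w_carrier: "w \<in> carrier_vec D"
  shows "vec_inner D (W *\<^sub>v v) (W *\<^sub>v w) = vec_inner D v w"
proof -
  have W_isometry: "W \<in> carrier_mat D D" "orthonormal_on {..<D} {..<D} (\<lambda>j i. W $$ (i,j))"
    using W_unitary by (simp_all add: unitary_mat_iff_orthonormal_cols)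
  have "vec_inner D (W *\<^sub>v v) (W *\<^sub>v w)
      = inner_on {..<D} (app_on {..<D} (entries W) (($) v)) (app_on {..<D} (entries W) (($) w))"
    using W_isometry(1) v_carrier w_carrier
    by (intro inner_on_cong) (simp_all only: lessThan_iff mult_mat_vec_nth)
  then show ?thesis
    using inner_on_isometry[OF _ W_isometry(2)] by simp
qed

lemma adj_mult:
  assumes "A \<in> carrier_mat m n" "B \<in> carrier_mat n p"
  shows "adj (A * B) = adj B * adj A"
proof (rule eq_matI)
  fix i j assume "i < dim_row (adj B * adj A)" "j < dim_col (adj B * adj A)"
  then show "adj (A * B) $$ (i,j) = (adj B * adj A) $$ (i,j)"
    using assms by (auto simp: scalar_prod_def mult.commute intro!: sum.cong)
qed (use assms in auto)

lemma unitary_mat_mult: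
  assumes A_unitary: "unitary_mat D A" and B_unitary: "unitary_mat D B"
  shows "unitary_mat D (A * B)"
proof -
  have carriers: "A \<in> carrier_mat D D" "B \<in> carrier_mat D D"
    using A_unitary B_unitary by (auto simp: unitary_mat_def)
  then have [simp]: "adj A \<in> carrier_mat D D" "adj B \<in> carrier_mat D D"
    by simp_all
  have "adj (A * B) * (A * B) = adj B * (adj A * (A * B))"
    using carriers by (simp add: adj_mult assoc_mult_mat[of _ D D _ D _ D])
  also have "adj A * (A * B) = (adj A * A) * B"
    using carriers by (simp add: assoc_mult_mat[of _ D D _ D _ D])
  also have "adj B * ((adj A * A) * B) = 1\<^sub>m D"
    using A_unitary B_unitary carriers by (simp add: unitary_mat_def)
  finally show ?thesis
    using carriers by (simp add: unitary_mat_def)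
qed

lemma unitary_mat_one: "unitary_mat D (1\<^sub>m D)"
  unfolding unitary_mat_def by (auto simp: adj_def mat_eq_iff)

definition rank_one_update :: "nat \<Rightarrow> complex \<Rightarrow> complex vec \<Rightarrow> complex mat" where
  "rank_one_update D c u = mat D D (\<lambda>(i,j). of_bool (i = j) + c * u $ i * cnj (u $ j))"

lemma unitary_rank_one_update:
  assumes "c + cnj c + c * cnj c * vec_inner D u u = 0"
  shows "unitary_mat D (rank_one_update D c u)"
proof (rule unitary_mat_if_orthonormal_rows)
  show "orthonormal_on {..<D} {..<D} (entries (rank_one_update D c u))"
    using orthonormal_on_rank_one_update[OF orthonormal_on_one assms]
    by (subst orthonormal_on_cong) (auto simp: rank_one_update_def app_on_one)
qed (simp add: rank_one_update_def)

lemma rank_one_update_mult_vec: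
  assumes "u \<in> carrier_vec D" "x \<in> carrier_vec D"
  shows "rank_one_update D c u *\<^sub>v x = x + (c * vec_inner D u x) \<cdot>\<^sub>v u"
proof (rule eq_vecI)
  fix i assume "i < dim_vec (x + (c * vec_inner D u x) \<cdot>\<^sub>v u)"
  then have i_less: "i < D"
    using assms by simp
  then have "(rank_one_update D c u *\<^sub>v x) $ i
      = (\<Sum>j<D. of_bool (i = j) * x $ j + c * u $ i * (cnj (u $ j) * x $ j))"
    using assms(2) by (subst mult_mat_vec_nth[of _ D D])
      (auto simp: rank_one_update_def app_on_def algebra_simps intro!: sum.cong)
  also have "\<dots> = x $ i + c * u $ i * vec_inner D u x"
    using i_less by (simp add: sum.distrib inner_on_def sum_distrib_left)
  finally show "(rank_one_update D c u *\<^sub>v x) $ i = (x + (c * vec_inner D u x) \<cdot>\<^sub>v u) $ i"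
    using i_less assms by (simp add: mult_ac)
qed (use assms in \<open>simp add: rank_one_update_def\<close>)

lemma vec_inner_diff_left:
  assumes "v \<in> carrier_vec D" "w \<in> carrier_vec D"
  shows "vec_inner D (v - w) x = vec_inner D v x - vec_inner D w x"
  unfolding inner_on_diff_left[symmetric] using assms by (auto intro!: inner_on_cong)

lemma vec_inner_diff_right:
  assumes "v \<in> carrier_vec D" "w \<in> carrier_vec D"
  shows "vec_inner D x (v - w) = vec_inner D x v - vec_inner D x w"
  unfolding inner_on_diff_right[symmetric] using assms by (auto intro!: inner_on_cong)

lemma vec_inner_self_eq_0D:
  assumes "v \<in> carrier_vec D" "vec_inner D v v = 0"
  shows "v = 0\<^sub>v D"
proof -
  have "sqnorm_on {..<D} (($) v) = 0"
    using assms(2) by (simp add: inner_on_self)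
  then have "v $ i = 0" if "i < D" for i
    using sqnorm_on_eq_0[of "{..<D}" "($) v" i] that by simp
  then show ?thesis
    using assms(1) by (intro eq_vecI) auto
qed

lemma unitary_reflection:
  assumes v_carrier: "v \<in> carrier_vec D" and w_carrier: "w \<in> carrier_vec D"
    and v_unit: "vec_inner D v v = 1" and w_unit: "vec_inner D w w = 1"
  shows "\<exists>R. unitary_mat D R \<and> R *\<^sub>v v = w \<and>
     (\<forall>x\<in>carrier_vec D. vec_inner D v x = 0 \<longrightarrow> vec_inner D w x = 0 \<longrightarrow> R *\<^sub>v x = x)"
proof -
  define u where "u = v - w"
  have u_carrier: "u \<in> carrier_vec D"
    using v_carrier w_carrier by (simp add: u_def)
  have inner_u: "vec_inner D u x = vec_inner D v x - vec_inner D w x" for x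
    unfolding u_def by (rule vec_inner_diff_left[OF v_carrier w_carrier])
  define \<alpha> where "\<alpha> = vec_inner D u v"
  have "vec_inner D v w = cnj (vec_inner D w v)"
    by (rule inner_on_commute)
  then have sqnorm_u: "vec_inner D u u = \<alpha> + cnj \<alpha>"
    using vec_inner_diff_right[OF v_carrier w_carrier] by (simp add: \<alpha>_def inner_u v_unit w_unit flip: u_def)
  \<comment> \<open>If \<open>\<alpha> = 0\<close>, then \<open>v = w\<close>, and \<open>- 1 / \<alpha> = 0\<close> turns \<open>?R\<close> into the identity.\<close>
  let ?R = "rank_one_update D (- 1 / \<alpha>) u"
  have "unitary_mat D ?R"
    by (rule unitary_rank_one_update, cases "\<alpha> = 0") (simp_all add: sqnorm_u field_simps)
  moreover have "?R *\<^sub>v v = w"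
  proof -
    have "w = v - u"
      using v_carrier w_carrier by (auto simp: u_def)
    moreover have "u = 0\<^sub>v D" if "\<alpha> = 0"
      using vec_inner_self_eq_0D[OF u_carrier] sqnorm_u that by simp
    moreover have "?R *\<^sub>v v = v + (- 1 / \<alpha> * \<alpha>) \<cdot>\<^sub>v u"
      by (simp add: rank_one_update_mult_vec[OF u_carrier v_carrier] \<alpha>_def)
    ultimately show ?thesis
      using u_carrier v_carrier by (cases "\<alpha> = 0") auto
  qed
  moreover have "?R *\<^sub>v x = x" if "x \<in> carrier_vec D" "vec_inner D v x = 0" "vec_inner D w x = 0" for x
    using that u_carrier by (simp add: rank_one_update_mult_vec[OF u_carrier] inner_u) auto
  ultimately show ?thesis
    by blast
qed

lemma unitary_extension_step:
  fixes m :: nat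
  assumes W_unitary: "unitary_mat D W" and W_maps: "\<And>i. i < m \<Longrightarrow> W *\<^sub>v v i = w i"
    and carriers: "\<And>i. i \<le> m \<Longrightarrow> v i \<in> carrier_vec D" "\<And>i. i \<le> m \<Longrightarrow> w i \<in> carrier_vec D"
    and orthonormal: "orthonormal_on {..m} {..<D} (\<lambda>i. ($) (v i))" "orthonormal_on {..m} {..<D} (\<lambda>i. ($) (w i))"
  shows "\<exists>W. unitary_mat D W \<and> (\<forall>i\<le>m. W *\<^sub>v v i = w i)"
proof -
  have inner_eq: "vec_inner D (v i) (v j) = of_bool (i = j)" "vec_inner D (w i) (w j) = of_bool (i = j)"
    if "i \<le> m" "j \<le> m" for i j
    using orthonormal that by (simp_all add: orthonormal_on_def)
  have W_carrier: "W \<in> carrier_mat D D"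
    using W_unitary by (simp add: unitary_mat_def)
  define x where "x = W *\<^sub>v v m"
  have "x \<in> carrier_vec D" and "vec_inner D x x = 1"
    using W_carrier carriers[of m] inner_eq[of m m] by (simp_all add: x_def vec_inner_unitary[OF W_unitary])
  then obtain R where R_unitary: "unitary_mat D R" and R_maps: "R *\<^sub>v x = w m"
    and R_fixes: "\<And>y. y \<in> carrier_vec D \<Longrightarrow> vec_inner D x y = 0 \<Longrightarrow> vec_inner D (w m) y = 0 \<Longrightarrow> R *\<^sub>v y = y"
    using unitary_reflection[of x D "w m"] carriers[of m] inner_eq[of m m] by auto
  have "R *\<^sub>v w i = w i" if "i < m" for i
  proof (rule R_fixes)
    show "vec_inner D x (w i) = 0"
      using vec_inner_unitary[OF W_unitary carriers(1) carriers(1), of m i] inner_eq(1)[of m i] that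
      by (simp add: W_maps x_def)
  qed (use carriers inner_eq that in auto)
  then have "R *\<^sub>v (W *\<^sub>v v i) = w i" if "i \<le> m" for i
    using that R_maps W_maps[of i] by (cases "i = m") (auto simp: x_def)
  then have "(R * W) *\<^sub>v v i = w i" if "i \<le> m" for i
    using that R_unitary W_carrier carriers(1)[of i]
    by (simp add: unitary_mat_def assoc_mult_mat_vec[of _ D D _ D])
  then show ?thesis
    using unitary_mat_mult[OF R_unitary W_unitary] by blast
qed

lemma unitary_mapping_orthonormal:
  fixes m :: nat
  assumes "\<And>i. i < m \<Longrightarrow> v i \<in> carrier_vec D" "\<And>i. i < m \<Longrightarrow> w i \<in> carrier_vec D"
    and "orthonormal_on {..<m} {..<D} (\<lambda>i. ($) (v i))" "orthonormal_on {..<m} {..<D} (\<lambda>i. ($) (w i))"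
  shows "\<exists>W. unitary_mat D W \<and> (\<forall>i<m. W *\<^sub>v v i = w i)"
  using assms
proof (induction m)
  case 0
  then show ?case
    using unitary_mat_one by blast
next
  case (Suc m)
  then obtain W where "unitary_mat D W" "\<And>i. i < m \<Longrightarrow> W *\<^sub>v v i = w i"
    by (auto simp: orthonormal_on_def)
  from unitary_extension_step[OF this] show ?case
    using Suc.prems by (simp add: less_Suc_eq_le lessThan_Suc_atMost)
qed

section \<open>Block vectors and block-diagonal matrices\<close>

lemma bij_betw_div_mod: "bij_betw (\<lambda>t::nat. (t div m, t mod m)) {..<D * m} ({..<D} \<times> {..<m})"
proof (rule bij_betw_byWitness[where f'="\<lambda>(x,i). x * m + i"])
  show "(\<lambda>t. (t div m, t mod m)) ` {..<D * m} \<subseteq> {..<D} \<times> {..<m}"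
    by (cases "m = 0") (auto simp: less_mult_imp_div_less)
  show "(\<lambda>(x,i). x * m + i) ` ({..<D} \<times> {..<m}) \<subseteq> {..<D * m}"
  proof clarsimp
    fix x i assume ranges: "x < D" "i < m"
    then have "x * m + i < Suc x * m"
      by simp
    also have "\<dots> \<le> D * m"
      using ranges by (intro mult_le_mono1) simp
    finally show "x * m + i < D * m" .
  qed
qed auto

lemma sum_div_mod:
  fixes g :: "nat \<Rightarrow> nat \<Rightarrow> 'a::comm_monoid_add"
  shows "(\<Sum>t<D * m. g (t div m) (t mod m)) = (\<Sum>x<D. \<Sum>i<m. g x i)"
  using sum.reindex_bij_betw[OF bij_betw_div_mod, of "\<lambda>(x,i). g x i"] by (simp add: sum.cartesian_product)

text \<open>Vectors and block-diagonal operators on \<open>\<complex>\<^sup>D \<otimes> \<complex>\<^sup>m\<close>, where the second factor is a classical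
  register that selects the block; the basis vector \<open>|x\<rangle>|i\<rangle>\<close> has index \<open>x * m + i\<close>.\<close>

definition block_vec :: "nat \<Rightarrow> nat \<Rightarrow> (nat \<Rightarrow> 'a vec) \<Rightarrow> 'a vec" where
  "block_vec D m f = vec (D * m) (\<lambda>t. f (t mod m) $ (t div m))"

definition block_mat :: "nat \<Rightarrow> nat \<Rightarrow> (nat \<Rightarrow> 'a::zero mat) \<Rightarrow> 'a mat" where
  "block_mat D m F = mat (D * m) (D * m)
     (\<lambda>(s,t). if s mod m = t mod m then F (s mod m) $$ (s div m, t div m) else 0)"

lemma block_vec_carrier [simp]: "block_vec D m f \<in> carrier_vec (D * m)"
  by (simp add: block_vec_def)

lemma block_mat_carrier [simp]: "block_mat D m F \<in> carrier_mat (D * m) (D * m)"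
  by (simp add: block_mat_def)

lemma block_index:
  assumes "(t::nat) < D * m"
  shows "t mod m < m" "t div m < D"
proof -
  have "m > 0"
    using assms by (cases m) auto
  then show "t mod m < m" "t div m < D"
    using assms by (simp_all add: less_mult_imp_div_less)
qed

lemma block_vec_cong:
  assumes "\<And>i. i < m \<Longrightarrow> f i = g i"
  shows "block_vec D m f = block_vec D m g"
  unfolding block_vec_def using assms block_index(1)[of _ D m] by (intro eq_vecI) auto

lemma block_mat_cong:
  assumes "\<And>i. i < m \<Longrightarrow> F i = G i"
  shows "block_mat D m F = block_mat D m G"
  unfolding block_mat_def using assms block_index(1)[of _ D m] by (intro eq_matI) auto

lemma block_mat_mult_vec:
  fixes F :: "nat \<Rightarrow> 'a::semiring_0 mat"
  assumes F_carrier: "\<And>i. i < m \<Longrightarrow> F i \<in> carrier_mat D D" and f_carrier: "\<And>i. i < m \<Longrightarrow> f i \<in> carrier_vec D"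
  shows "block_mat D m F *\<^sub>v block_vec D m f = block_vec D m (\<lambda>i. F i *\<^sub>v f i)"
proof (rule eq_vecI)
  fix s assume "s < dim_vec (block_vec D m (\<lambda>i. F i *\<^sub>v f i))"
  then have s_less: "s < D * m"
    by (simp add: block_vec_def)
  have "(block_mat D m F *\<^sub>v block_vec D m f) $ s
    = (\<Sum>t<D * m. (\<lambda>x i. if s mod m = i then F i $$ (s div m, x) * f i $ x else 0) (t div m) (t mod m))"
    using s_less by (auto simp: block_mat_def block_vec_def scalar_prod_def atLeast0LessThan intro!: sum.cong)
  also have "\<dots> = (\<Sum>x<D. \<Sum>i<m. if s mod m = i then F i $$ (s div m, x) * f i $ x else 0)"
    by (rule sum_div_mod)
  also have "\<dots> = (\<Sum>x<D. F (s mod m) $$ (s div m, x) * f (s mod m) $ x)"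
    using block_index[OF s_less] by simp
  also have "\<dots> = block_vec D m (\<lambda>i. F i *\<^sub>v f i) $ s"
    using F_carrier[of "s mod m"] f_carrier[of "s mod m"] block_index[OF s_less] s_less
    by (auto simp: block_vec_def scalar_prod_def atLeast0LessThan intro!: sum.cong)
  finally show "(block_mat D m F *\<^sub>v block_vec D m f) $ s = block_vec D m (\<lambda>i. F i *\<^sub>v f i) $ s" .
qed (simp add: block_vec_def block_mat_def)

lemma block_mat_mult:
  fixes F :: "nat \<Rightarrow> 'a::semiring_0 mat"
  assumes F_carrier: "\<And>i. i < m \<Longrightarrow> F i \<in> carrier_mat D D" and G_carrier: "\<And>i. i < m \<Longrightarrow> G i \<in> carrier_mat D D"
  shows "block_mat D m F * block_mat D m G = block_mat D m (\<lambda>i. F i * G i)"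
proof (rule eq_matI)
  fix s r assume "s < dim_row (block_mat D m (\<lambda>i. F i * G i))" "r < dim_col (block_mat D m (\<lambda>i. F i * G i))"
  then have indices: "s < D * m" "r < D * m"
    by (simp_all add: block_mat_def)
  let ?FG = "\<lambda>x i. if s mod m = i
    then if i = r mod m then F i $$ (s div m, x) * G i $$ (x, r div m) else 0 else 0"
  have "(block_mat D m F * block_mat D m G) $$ (s,r) = (\<Sum>t<D * m. ?FG (t div m) (t mod m))"
    using indices by (auto simp: block_mat_def scalar_prod_def atLeast0LessThan intro!: sum.cong)
  also have "\<dots> = (\<Sum>x<D. \<Sum>i<m. ?FG x i)"
    by (rule sum_div_mod)
  also have "\<dots> = (if s mod m = r mod m
      then \<Sum>x<D. F (s mod m) $$ (s div m, x) * G (s mod m) $$ (x, r div m) else 0)"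
    using block_index[OF indices(1)] by simp
  also have "\<dots> = block_mat D m (\<lambda>i. F i * G i) $$ (s,r)"
    using F_carrier[of "s mod m"] G_carrier[of "s mod m"] indices
      block_index[OF indices(1)] block_index[OF indices(2)]
    by (auto simp: block_mat_def scalar_prod_def atLeast0LessThan intro!: sum.cong)
  finally show "(block_mat D m F * block_mat D m G) $$ (s,r) = block_mat D m (\<lambda>i. F i * G i) $$ (s,r)" .
qed (simp_all add: block_mat_def)

lemma adj_block_mat:
  assumes "\<And>i. i < m \<Longrightarrow> F i \<in> carrier_mat D D"
  shows "adj (block_mat D m F) = block_mat D m (\<lambda>i. adj (F i))"
proof (rule eq_matI)
  fix s r assume "s < dim_row (block_mat D m (\<lambda>i. adj (F i)))" "r < dim_col (block_mat D m (\<lambda>i. adj (F i)))"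
  then have indices: "s < D * m" "r < D * m"
    by (simp_all add: block_mat_def)
  then show "adj (block_mat D m F) $$ (s,r) = block_mat D m (\<lambda>i. adj (F i)) $$ (s,r)"
    using assms[of "s mod m"] block_index[OF indices(1)] block_index[OF indices(2)]
    by (auto simp: block_mat_def)
qed (simp_all add: block_mat_def)

lemma block_mat_one: "block_mat D m (\<lambda>_. 1\<^sub>m D) = 1\<^sub>m (D * m)"
proof (rule eq_matI)
  fix s r assume "s < dim_row (1\<^sub>m (D * m) :: 'a mat)" "r < dim_col (1\<^sub>m (D * m) :: 'a mat)"
  then have indices: "s < D * m" "r < D * m"
    by simp_all
  have "s = r \<longleftrightarrow> s mod m = r mod m \<and> s div m = r div m"
    by (metis div_mult_mod_eq)
  then show "block_mat D m (\<lambda>_. 1\<^sub>m D) $$ (s,r) = 1\<^sub>m (D * m) $$ (s,r)"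
    using indices block_index[OF indices(1)] block_index[OF indices(2)] by (simp add: block_mat_def)
qed (simp_all add: block_mat_def)

lemma unitary_block_mat:
  assumes "\<And>i. i < m \<Longrightarrow> unitary_mat D (F i)"
  shows "unitary_mat (D * m) (block_mat D m F)"
proof -
  have "adj (block_mat D m F) * block_mat D m F = block_mat D m (\<lambda>i. adj (F i) * F i)"
    using assms by (simp add: adj_block_mat block_mat_mult unitary_mat_def)
  also have "\<dots> = block_mat D m (\<lambda>_. 1\<^sub>m D)"
    using assms by (intro block_mat_cong) (simp add: unitary_mat_def)
  finally show ?thesis
    by (simp add: unitary_mat_def block_mat_one)
qed

lemma kron_id_eq_block_mat: "U \<in> carrier_mat N N \<Longrightarrow> kron_id d U = block_mat N d (\<lambda>_. U)"
  by (auto simp: kron_id_def block_mat_def)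

lemma kron_id_carrier: "U \<in> carrier_mat N N \<Longrightarrow> kron_id d U \<in> carrier_mat (N * d) (N * d)"
  by (simp add: kron_id_def)

lemma kron_id_mult:
  assumes U_carrier: "U \<in> carrier_mat N N"
  shows "kron_id (d * m) U = block_mat (N * d) m (\<lambda>_. kron_id d U)"
proof (rule eq_matI)
  fix s r
  assume "s < dim_row (block_mat (N * d) m (\<lambda>_. kron_id d U))"
    and "r < dim_col (block_mat (N * d) m (\<lambda>_. kron_id d U))"
  then have indices: "s < N * d * m" "r < N * d * m"
    by (simp_all add: block_mat_def)
  have m_pos: "m > 0"
    using indices by (cases m) auto
  have "s mod (m * d) = r mod (m * d) \<longleftrightarrow> s mod m = r mod m \<and> s div m mod d = r div m mod d"
  proof
    assume "s mod (m * d) = r mod (m * d)"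
    then have "s mod (m * d) mod m = r mod (m * d) mod m" "s mod (m * d) div m = r mod (m * d) div m"
      by simp_all
    then show "s mod m = r mod m \<and> s div m mod d = r div m mod d"
      using m_pos by (simp add: mod_mult2_eq)
  qed (simp add: mod_mult2_eq)
  then show "kron_id (d * m) U $$ (s,r) = block_mat (N * d) m (\<lambda>_. kron_id d U) $$ (s,r)"
    using U_carrier indices block_index[OF indices(1)] block_index[OF indices(2)]
    by (auto simp: block_mat_def kron_id_def div_mult2_eq mult.commute[of d m] mult.assoc)
qed (use U_carrier in \<open>simp_all add: block_mat_def kron_id_def mult.assoc\<close>)

lemma vec_inner_block_vec:
  "vec_inner (D * m) (block_vec D m f) (block_vec D m g) = (\<Sum>i<m. vec_inner D (f i) (g i))"
proof -
  have "vec_inner (D * m) (block_vec D m f) (block_vec D m g)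
     = (\<Sum>t<D * m. (\<lambda>x i. cnj (f i $ x) * g i $ x) (t div m) (t mod m))"
    unfolding inner_on_def by (intro sum.cong refl) (simp add: block_vec_def)
  also have "\<dots> = (\<Sum>x<D. \<Sum>i<m. cnj (f i $ x) * g i $ x)"
    by (rule sum_div_mod)
  also have "\<dots> = (\<Sum>i<m. vec_inner D (f i) (g i))"
    unfolding inner_on_def by (rule sum.swap)
  finally show ?thesis .
qed

lemma vec_inner_self: "v \<in> carrier_vec D \<Longrightarrow> vec_inner D v v = of_real (vnorm_sq v)"
  by (auto simp: inner_on_self sqnorm_on_def vnorm_sq_def)

lemma vnorm_sq_block_vec:
  assumes "\<And>i. i < m \<Longrightarrow> f i \<in> carrier_vec D"
  shows "vnorm_sq (block_vec D m f) = (\<Sum>i<m. vnorm_sq (f i))"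
proof -
  have "complex_of_real (vnorm_sq (block_vec D m f)) = complex_of_real (\<Sum>i<m. vnorm_sq (f i))"
    using vec_inner_block_vec[of D m f f] assms by (simp add: vec_inner_self)
  then show ?thesis
    by (simp only: of_real_eq_iff)
qed

lemma vnorm_sq_smult: "vnorm_sq (c \<cdot>\<^sub>v v) = (cmod c)\<^sup>2 * vnorm_sq v"
  by (simp add: vnorm_sq_def norm_mult power_mult_distrib sum_distrib_left)


section \<open>Sequential composition of query algorithms\<close>

definition query_run :: "complex mat \<Rightarrow> complex mat list \<Rightarrow> complex vec \<Rightarrow> complex vec" where
  "query_run K Ws s = fold (\<lambda>W s. W *\<^sub>v (K *\<^sub>v s)) Ws s"

lemma final_state_eq_query_run: "final_state A U = query_run (kron_id (anc A) U) (ops A) (init A)"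
  by (simp add: final_state_def query_run_def)

lemma query_run_carrier:
  assumes "K \<in> carrier_mat D D" "\<And>W. W \<in> set Ws \<Longrightarrow> W \<in> carrier_mat D D" "s \<in> carrier_vec D"
  shows "query_run K Ws s \<in> carrier_vec D"
  using assms(2,3)
proof (induction Ws arbitrary: s)
  case (Cons W Ws)
  then show ?case
    using assms(1) by (simp add: query_run_def mult_mat_vec_carrier[of _ D D])
qed (simp add: query_run_def)

lemma query_run_smult:
  assumes "K \<in> carrier_mat D D" "\<And>W. W \<in> set Ws \<Longrightarrow> W \<in> carrier_mat D D" "s \<in> carrier_vec D"
  shows "query_run K Ws (c \<cdot>\<^sub>v s) = c \<cdot>\<^sub>v query_run K Ws s"
  using assms(2,3)
proof (induction Ws arbitrary: s)
  case (Cons W Ws)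
  then have W_carrier: "W \<in> carrier_mat D D" and Ks_carrier: "K *\<^sub>v s \<in> carrier_vec D"
    using assms(1) by (simp_all add: mult_mat_vec_carrier[of _ D D])
  have "W *\<^sub>v (K *\<^sub>v (c \<cdot>\<^sub>v s)) = c \<cdot>\<^sub>v (W *\<^sub>v (K *\<^sub>v s))"
    unfolding mult_mat_vec[OF assms(1) Cons.prems(2)] mult_mat_vec[OF W_carrier Ks_carrier] ..
  then show ?case
    using Cons W_carrier Ks_carrier by (simp add: query_run_def mult_mat_vec_carrier[of _ D D])
qed (simp add: query_run_def)

lemma query_run_block:
  assumes K_carrier: "K \<in> carrier_mat D D"
    and Ws_carrier: "\<And>i W. i < m \<Longrightarrow> W \<in> set (Ws i) \<Longrightarrow> W \<in> carrier_mat D D"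
    and length_Ws: "\<And>i. i < m \<Longrightarrow> length (Ws i) = q"
    and f_carrier: "\<And>i. i < m \<Longrightarrow> f i \<in> carrier_vec D"
  shows "query_run (block_mat D m (\<lambda>_. K)) (map (\<lambda>j. block_mat D m (\<lambda>i. Ws i ! j)) [0..<q]) (block_vec D m f)
    = block_vec D m (\<lambda>i. query_run K (Ws i) (f i))"
proof -
  let ?K = "block_mat D m (\<lambda>_. K)" and ?W = "\<lambda>j. block_mat D m (\<lambda>i. Ws i ! j)"
  have "query_run ?K (map ?W [0..<p]) (block_vec D m f)
      = block_vec D m (\<lambda>i. query_run K (take p (Ws i)) (f i))"
    if "p \<le> q" for p
    using that
  proof (induction p)
    case (Suc p)
    let ?s = "\<lambda>i. query_run K (take p (Ws i)) (f i)"
    have state_carrier: "?s i \<in> carrier_vec D" if "i < m" for i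
      by (rule query_run_carrier[OF K_carrier]) (use that Ws_carrier f_carrier in \<open>auto dest: in_set_takeD\<close>)
    have nth_carrier: "Ws i ! p \<in> carrier_mat D D" if "i < m" for i
      using Ws_carrier[OF that nth_mem] length_Ws[OF that] Suc.prems by simp
    have "query_run ?K (map ?W [0..<Suc p]) (block_vec D m f) = ?W p *\<^sub>v (?K *\<^sub>v block_vec D m ?s)"
      using Suc by (simp add: query_run_def)
    also have "\<dots> = block_vec D m (\<lambda>i. Ws i ! p *\<^sub>v (K *\<^sub>v ?s i))"
      using K_carrier state_carrier nth_carrier by (simp add: block_mat_mult_vec mult_mat_vec_carrier[of _ D D])
    also have "\<dots> = block_vec D m (\<lambda>i. query_run K (take (Suc p) (Ws i)) (f i))"
      using length_Ws Suc.prems by (intro block_vec_cong) (simp add: query_run_def take_Suc_conv_app_nth)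
    finally show ?case .
  qed (simp add: query_run_def)
  from this[of q] show ?thesis
    using length_Ws by (simp cong: block_vec_cong)
qed

text \<open>The normalized state \<open>(M \<otimes> I)|\<Phi>\<rangle>\<close> where \<open>|\<Phi>\<rangle>\<close> is maximally entangled between the system and
  the first \<open>N\<close> levels of the \<open>m\<close>-dimensional register, with a further ancilla of dimension \<open>d\<close>
  initialized to zero.\<close>

definition choi_vec :: "nat \<Rightarrow> nat \<Rightarrow> nat \<Rightarrow> (nat \<Rightarrow> nat \<Rightarrow> complex) \<Rightarrow> complex vec" where
  "choi_vec N d m M = block_vec (N * d) m (\<lambda>r. block_vec N d (\<lambda>a. vec N (\<lambda>x.
     if a = 0 \<and> r < N then M x r / sqrt (real N) else 0)))"

lemma choi_vec_carrier [simp]: "choi_vec N d m M \<in> carrier_vec (N * d * m)"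
  by (simp add: choi_vec_def)

lemma vec_inner_choi_vec:
  assumes d_pos: "d \<ge> 1" and N_le_m: "N \<le> m"
  shows "vec_inner (N * d * m) (choi_vec N d m M) (choi_vec N d m M') = hs_inner_on {..<N} M M' / N"
proof -
  have "complex_of_real (sqrt (real N)) * complex_of_real (sqrt (real N)) = N"
    by (simp flip: of_real_mult)
  then have "vec_inner (N * d * m) (choi_vec N d m M) (choi_vec N d m M')
      = (\<Sum>r<m. \<Sum>a<d. if a = 0 then if r < N then \<Sum>x<N. cnj (M x r) * M' x r / N else 0 else 0)"
    unfolding choi_vec_def vec_inner_block_vec
    by (intro sum.cong refl) (simp add: inner_on_def)
  also have "\<dots> = (\<Sum>r<m. if r < N then \<Sum>x<N. cnj (M x r) * M' x r / N else 0)"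
    using d_pos by simp
  also have "\<dots> = (\<Sum>r<N. \<Sum>x<N. cnj (M x r) * M' x r / N)"
    using N_le_m by (intro sum.mono_neutral_cong_right) auto
  also have "\<dots> = hs_inner_on {..<N} M M' / N"
    unfolding hs_inner_on_def inner_on_def sum_divide_distrib by (rule sum.swap)
  finally show ?thesis .
qed

lemma kron_id_mult_choi_vec_one:
  assumes U_carrier: "U \<in> carrier_mat N N"
  shows "kron_id (d * m) U *\<^sub>v choi_vec N d m (\<lambda>x y. of_bool (x = y)) = choi_vec N d m (entries U)"
proof -
  have "U *\<^sub>v vec N (\<lambda>x. if a = 0 \<and> r < N then (of_bool (x = r) :: complex) / sqrt (real N) else 0)
      = vec N (\<lambda>x. if a = 0 \<and> r < N then U $$ (x,r) / sqrt (real N) else 0)" for a r :: nat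
    using U_carrier
    by (intro eq_vecI) (auto simp: scalar_prod_def atLeast0LessThan simp flip: sum_divide_distrib)
  then show ?thesis
    unfolding choi_vec_def kron_id_mult[OF U_carrier]
    by (simp add: block_mat_mult_vec kron_id_eq_block_mat[OF U_carrier] U_carrier)
qed

lemma choi_vec_sum:
  assumes M_sum: "\<And>x y. x < N \<Longrightarrow> y < N \<Longrightarrow> M x y = (\<Sum>i\<in>I. c i * e i x y)" and t_less: "t < N * d * m"
  shows "choi_vec N d m M $ t = (\<Sum>i\<in>I. c i * choi_vec N d m (e i) $ t)"
proof -
  have "choi_vec N d m L $ t
      = (if t div m mod d = 0 \<and> t mod m < N then L (t div m div d) (t mod m) / sqrt (real N) else 0)" for L
    using t_less block_index[OF t_less] block_index[of "t div m" N d] by (simp add: choi_vec_def block_vec_def)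
  then show ?thesis
    using block_index[OF t_less] block_index[of "t div m" N d] by (simp add: M_sum sum_divide_distrib)
qed

lemma mult_mat_vec_sum:
  fixes W :: "complex mat"
  assumes W_carrier: "W \<in> carrier_mat n D" and s_carrier: "s \<in> carrier_vec D"
    and v_carrier: "\<And>i. i \<in> I \<Longrightarrow> v i \<in> carrier_vec D"
    and s_sum: "\<And>t. t < D \<Longrightarrow> s $ t = (\<Sum>i\<in>I. c i * v i $ t)" and t_less: "t < n"
  shows "(W *\<^sub>v s) $ t = (\<Sum>i\<in>I. c i * (W *\<^sub>v v i) $ t)"
proof -
  have "(W *\<^sub>v s) $ t = (\<Sum>l<D. \<Sum>i\<in>I. c i * (W $$ (t,l) * v i $ l))"
    unfolding mult_mat_vec_nth[OF W_carrier s_carrier t_less] app_on_def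
    by (intro sum.cong refl) (simp add: s_sum sum_distrib_left mult.left_commute)
  also have "\<dots> = (\<Sum>i\<in>I. c i * (W *\<^sub>v v i) $ t)"
    by (subst sum.swap) (simp add: mult_mat_vec_nth[OF W_carrier v_carrier t_less] app_on_def sum_distrib_left)
  finally show ?thesis .
qed

definition tagged_vec :: "nat \<Rightarrow> nat \<Rightarrow> nat \<Rightarrow> complex vec \<Rightarrow> complex vec" where
  "tagged_vec D m i v = block_vec D m (\<lambda>j. if j = i then v else 0\<^sub>v D)"

lemma vec_inner_tagged_vec:
  assumes "i < m" "j < m"
  shows "vec_inner (D * m) (tagged_vec D m i v) (tagged_vec D m j w) = of_bool (i = j) * vec_inner D v w"
proof -
  have "vec_inner (D * m) (tagged_vec D m i v) (tagged_vec D m j w)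
      = (\<Sum>l<m. if l = i then of_bool (i = j) * vec_inner D v w else 0)"
    unfolding tagged_vec_def vec_inner_block_vec by (intro sum.cong refl) (auto simp: inner_on_def)
  then show ?thesis
    using assms by simp
qed

definition basis_coeff :: "nat \<Rightarrow> (nat \<Rightarrow> nat \<Rightarrow> nat \<Rightarrow> complex) \<Rightarrow> (nat \<Rightarrow> nat \<Rightarrow> complex) \<Rightarrow> nat \<Rightarrow> complex" where
  "basis_coeff N e M i = hs_inner_on {..<N} (e i) M / N"

definition operator_basis :: "nat \<Rightarrow> (nat \<Rightarrow> nat \<Rightarrow> nat \<Rightarrow> complex) \<Rightarrow> bool" where
  "operator_basis N e \<longleftrightarrow>
     (\<forall>i<N * N. \<forall>j<N * N. hs_inner_on {..<N} (e i) (e j) = of_nat N * of_bool (i = j)) \<and>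
     (\<forall>M. \<forall>x<N. \<forall>y<N. M x y = (\<Sum>i<N * N. basis_coeff N e M i * e i x y))"

text \<open>The measurement in the basis \<open>e\<close> is deferred: \<open>W\<close> coherently maps the \<open>i\<close>-th basis state to
  \<open>|i\<rangle>\<close> together with the state \<open>s i\<close> from which to continue after outcome \<open>i\<close>.\<close>

lemma exists_basis_measurement:
  assumes N_pos: "N \<ge> 1" and d_pos: "d \<ge> 1" and e_basis: "operator_basis N e"
    and s_unit: "\<And>i. i < N * N \<Longrightarrow> s i \<in> carrier_vec (N * d)" "\<And>i. i < N * N \<Longrightarrow> vnorm_sq (s i) = 1"
  shows "\<exists>W. unitary_mat (N * d * (N * N)) W \<and> (\<forall>M. W *\<^sub>v choi_vec N d (N * N) M
    = block_vec (N * d) (N * N) (\<lambda>i. basis_coeff N e M i \<cdot>\<^sub>v s i))"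
proof -
  let ?m = "N * N" and ?D = "N * d"
  let ?v = "\<lambda>i. choi_vec N d ?m (e i)" and ?w = "\<lambda>i. tagged_vec ?D ?m i (s i)"
  have "N \<le> ?m"
    by simp
  then have "orthonormal_on {..<?m} {..<?D * ?m} (\<lambda>i. ($) (?v i))"
    using e_basis N_pos d_pos by (simp add: orthonormal_on_def operator_basis_def vec_inner_choi_vec)
  moreover have "orthonormal_on {..<?m} {..<?D * ?m} (\<lambda>i. ($) (?w i))"
    using s_unit by (auto simp: orthonormal_on_def vec_inner_tagged_vec vec_inner_self[of _ ?D])
  ultimately obtain W where W_unitary: "unitary_mat (?D * ?m) W" and W_maps: "\<And>i. i < ?m \<Longrightarrow> W *\<^sub>v ?v i = ?w i"
    using unitary_mapping_orthonormal[of ?m ?v "?D * ?m" ?w] by (auto simp: tagged_vec_def)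
  then have W_carrier: "W \<in> carrier_mat (?D * ?m) (?D * ?m)"
    by (simp add: unitary_mat_def)
  have "W *\<^sub>v choi_vec N d ?m M = block_vec ?D ?m (\<lambda>i. basis_coeff N e M i \<cdot>\<^sub>v s i)" for M
  proof (rule eq_vecI)
    fix t assume "t < dim_vec (block_vec ?D ?m (\<lambda>i. basis_coeff N e M i \<cdot>\<^sub>v s i))"
    then have t_less: "t < ?D * ?m"
      by (simp add: block_vec_def)
    have "choi_vec N d ?m M $ l = (\<Sum>i<?m. basis_coeff N e M i * ?v i $ l)" if "l < ?D * ?m" for l
      using e_basis that by (intro choi_vec_sum) (auto simp: operator_basis_def)
    then have "(W *\<^sub>v choi_vec N d ?m M) $ t = (\<Sum>i<?m. basis_coeff N e M i * (W *\<^sub>v ?v i) $ t)"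
      by (intro mult_mat_vec_sum[OF W_carrier _ _ _ t_less]) simp_all
    also have "\<dots> = (\<Sum>i<?m. if t mod ?m = i then basis_coeff N e M i * s i $ (t div ?m) else 0)"
      using t_less block_index[OF t_less] by (intro sum.cong refl) (simp add: W_maps tagged_vec_def block_vec_def)
    also have "\<dots> = block_vec ?D ?m (\<lambda>i. basis_coeff N e M i \<cdot>\<^sub>v s i) $ t"
      using t_less block_index[OF t_less] s_unit(1)[of "t mod ?m"] by (simp add: block_vec_def)
    finally show "(W *\<^sub>v choi_vec N d ?m M) $ t = block_vec ?D ?m (\<lambda>i. basis_coeff N e M i \<cdot>\<^sub>v s i) $ t" .
  qed (use W_carrier in \<open>simp add: block_vec_def\<close>)
  with W_unitary show ?thesis
    by blast
qed

definition qalg_of_shape :: "nat \<Rightarrow> nat \<Rightarrow> nat \<Rightarrow> qalg \<Rightarrow> bool" where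
  "qalg_of_shape N d q A \<longleftrightarrow> valid_qalg N A \<and> anc A = d \<and> num_queries A = q"

lemma
  assumes "qalg_of_shape N d q A"
  shows qalg_of_shape_anc_pos: "d \<ge> 1"
    and qalg_of_shape_anc: "anc A = d"
    and qalg_of_shape_length_ops: "length (ops A) = q"
    and qalg_of_shape_init_carrier: "init A \<in> carrier_vec (N * d)"
    and qalg_of_shape_init_unit: "vnorm_sq (init A) = 1"
    and qalg_of_shape_ops_unitary: "W \<in> set (ops A) \<Longrightarrow> unitary_mat (N * d) W"
    and qalg_of_shape_ops_carrier: "W \<in> set (ops A) \<Longrightarrow> W \<in> carrier_mat (N * d) (N * d)"
    and qalg_of_shape_acc_carrier: "acc A \<in> carrier_mat (N * d) (N * d)"
    and qalg_of_shape_acc_idem: "acc A * acc A = acc A"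
    and qalg_of_shape_adj_acc: "adj (acc A) = acc A"
  using assms by (auto simp: qalg_of_shape_def valid_qalg_def num_queries_def unitary_mat_def)

text \<open>One query on half of a maximally entangled state, the operation \<open>W\<close>, and then the algorithm
  \<open>A i\<close> selected by the register value \<open>i\<close>.\<close>

definition branch_qalg :: "nat \<Rightarrow> nat \<Rightarrow> nat \<Rightarrow> nat \<Rightarrow> complex mat \<Rightarrow> (nat \<Rightarrow> qalg) \<Rightarrow> qalg" where
  "branch_qalg N d m q W A = \<lparr>anc = d * m,
     init = choi_vec N d m (\<lambda>x y. of_bool (x = y)),
     ops = W # map (\<lambda>j. block_mat (N * d) m (\<lambda>i. ops (A i) ! j)) [0..<q],
     acc = block_mat (N * d) m (\<lambda>i. acc (A i))\<rparr>"

lemma vnorm_sq_choi_vec_one: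
  assumes "N \<ge> 1" "d \<ge> 1" "N \<le> m"
  shows "vnorm_sq (choi_vec N d m (\<lambda>x y. of_bool (x = y))) = 1"
proof -
  have "complex_of_real (vnorm_sq (choi_vec N d m (\<lambda>x y. of_bool (x = y)))) = complex_of_real 1"
    using assms unfolding vec_inner_self[OF choi_vec_carrier, symmetric] vec_inner_choi_vec[OF assms(2,3)]
    by (simp add: hs_inner_on_self hs_sqnorm_on_orthonormal orthonormal_on_def inner_on_def)
  then show ?thesis
    by (simp only: of_real_eq_iff)
qed

lemma qalg_of_shape_branch_qalg:
  assumes N_range: "N \<ge> 1" "N \<le> m" and W_unitary: "unitary_mat (N * d * m) W"
    and A_shape: "\<And>i. i < m \<Longrightarrow> qalg_of_shape N d q (A i)"
  shows "qalg_of_shape N (d * m) (Suc q) (branch_qalg N d m q W A)"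
proof -
  have m_pos: "m \<ge> 1" and d_pos: "d \<ge> 1"
    using N_range qalg_of_shape_anc_pos[OF A_shape, of 0] by auto
  have acc_carrier: "acc (A i) \<in> carrier_mat (N * d) (N * d)" if "i < m" for i
    by (rule qalg_of_shape_acc_carrier[OF A_shape[OF that]])
  have "unitary_mat (N * d * m) (block_mat (N * d) m (\<lambda>i. ops (A i) ! j))" if "j < q" for j
    using qalg_of_shape_length_ops[OF A_shape] qalg_of_shape_ops_unitary[OF A_shape] that
    by (intro unitary_block_mat) (metis nth_mem)
  moreover have "block_mat (N * d) m (\<lambda>i. acc (A i)) * block_mat (N * d) m (\<lambda>i. acc (A i))
      = block_mat (N * d) m (\<lambda>i. acc (A i))"
    using acc_carrier qalg_of_shape_acc_idem[OF A_shape]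
    by (simp add: block_mat_mult cong: block_mat_cong)
  moreover have "adj (block_mat (N * d) m (\<lambda>i. acc (A i))) = block_mat (N * d) m (\<lambda>i. acc (A i))"
    using acc_carrier qalg_of_shape_adj_acc[OF A_shape]
    by (simp add: adj_block_mat cong: block_mat_cong)
  moreover have dim_eq: "N * (d * m) = N * d * m"
    by simp
  ultimately show ?thesis
    unfolding qalg_of_shape_def valid_qalg_def num_queries_def branch_qalg_def qalg.simps dim_eq
    using m_pos d_pos W_unitary vnorm_sq_choi_vec_one[OF N_range(1) d_pos N_range(2)] by auto
qed

lemma accept_prob_branch_qalg:
  assumes U_carrier: "U \<in> carrier_mat N N" and A_shape: "\<And>i. i < m \<Longrightarrow> qalg_of_shape N d q (A i)"
    and W_measures: "W *\<^sub>v choi_vec N d m (entries U) = block_vec (N * d) m (\<lambda>i. c i \<cdot>\<^sub>v init (A i))"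
  shows "accept_prob (branch_qalg N d m q W A) U = (\<Sum>i<m. (cmod (c i))\<^sup>2 * accept_prob (A i) U)"
proof -
  let ?D = "N * d" and ?B = "branch_qalg N d m q W A" and ?K = "kron_id d U"
  have K_carrier: "?K \<in> carrier_mat ?D ?D"
    by (rule kron_id_carrier[OF U_carrier])
  note init_carrier = qalg_of_shape_init_carrier[OF A_shape]
    and ops_carrier = qalg_of_shape_ops_carrier[OF A_shape]
    and acc_carrier = qalg_of_shape_acc_carrier[OF A_shape]
  have final_eq: "final_state (A i) U = query_run ?K (ops (A i)) (init (A i))" if "i < m" for i
    using qalg_of_shape_anc[OF A_shape[OF that]] by (simp add: final_state_eq_query_run)
  then have final_carrier: "final_state (A i) U \<in> carrier_vec ?D" if "i < m" for i
    using query_run_carrier[OF K_carrier ops_carrier init_carrier] that by simp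
  have "final_state ?B U = query_run (block_mat ?D m (\<lambda>_. ?K))
      (map (\<lambda>j. block_mat ?D m (\<lambda>i. ops (A i) ! j)) [0..<q]) (block_vec ?D m (\<lambda>i. c i \<cdot>\<^sub>v init (A i)))"
    by (simp add: final_state_eq_query_run branch_qalg_def query_run_def W_measures
        kron_id_mult_choi_vec_one[OF U_carrier])
      (simp add: kron_id_mult[OF U_carrier])
  also have "\<dots> = block_vec ?D m (\<lambda>i. query_run ?K (ops (A i)) (c i \<cdot>\<^sub>v init (A i)))"
    using init_carrier ops_carrier qalg_of_shape_length_ops[OF A_shape]
    by (intro query_run_block K_carrier) auto
  also have "\<dots> = block_vec ?D m (\<lambda>i. c i \<cdot>\<^sub>v final_state (A i) U)"
    using query_run_smult[OF K_carrier ops_carrier init_carrier] by (intro block_vec_cong) (simp add: final_eq)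
  finally have "acc ?B *\<^sub>v final_state ?B U = block_vec ?D m (\<lambda>i. acc (A i) *\<^sub>v (c i \<cdot>\<^sub>v final_state (A i) U))"
    using acc_carrier final_carrier by (simp add: branch_qalg_def block_mat_mult_vec)
  also have "\<dots> = block_vec ?D m (\<lambda>i. c i \<cdot>\<^sub>v (acc (A i) *\<^sub>v final_state (A i) U))"
    using acc_carrier final_carrier by (intro block_vec_cong) (simp add: mult_mat_vec[of _ ?D ?D])
  finally show ?thesis
    using acc_carrier final_carrier
    by (simp add: accept_prob_def vnorm_sq_block_vec vnorm_sq_smult mult_mat_vec_carrier[of _ ?D ?D])
qed

section \<open>Sampling random sets\<close>

text \<open>The probability that \<open>T\<close> and \<open>q\<close> independent samples \<open>s i\<close>, where \<open>i\<close> has probability \<open>p i\<close>,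
  cover at most \<open>k\<close> elements in total.\<close>

primrec cover_prob :: "'i set \<Rightarrow> ('i \<Rightarrow> real) \<Rightarrow> ('i \<Rightarrow> 'a set) \<Rightarrow> nat \<Rightarrow> nat \<Rightarrow> 'a set \<Rightarrow> real" where
  "cover_prob I p s k 0 T = of_bool (card T \<le> k)"
| "cover_prob I p s k (Suc q) T = (\<Sum>i\<in>I. p i * cover_prob I p s k q (T \<union> s i))"

definition cover_potential :: "nat \<Rightarrow> 'a set \<Rightarrow> real" where
  "cover_potential k T = (if card T \<le> k then 2 ^ (k - card T) else 0)"

lemma cover_prob_nonneg: "(\<And>i. i \<in> I \<Longrightarrow> 0 \<le> p i) \<Longrightarrow> 0 \<le> cover_prob I p s k q T"
  by (induction q arbitrary: T) (auto intro!: sum_nonneg)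

lemma cover_prob_reindex:
  assumes "bij_betw h I J"
  shows "cover_prob J p s k q T = cover_prob I (\<lambda>i. p (h i)) (\<lambda>i. s (h i)) k q T"
proof (induction q arbitrary: T)
  case (Suc q)
  show ?case
    unfolding cover_prob.simps Suc by (rule sum.reindex_bij_betw[OF assms, symmetric])
qed simp

lemma cover_prob_ge_1:
  assumes p_weights: "finite I" "\<And>i. i \<in> I \<Longrightarrow> 0 \<le> p i" and T_small: "finite T" "card T \<le> k"
    and total_in_T: "(\<Sum>i | i \<in> I \<and> s i \<subseteq> T. p i) = 1" and R_subset: "R \<subseteq> T"
  shows "1 \<le> cover_prob I p s k q R"
  using R_subset
proof (induction q arbitrary: R)
  case 0
  then show ?case
    using T_small card_mono[OF T_small(1) 0] by simp
next
  case (Suc q)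
  have "1 = (\<Sum>i | i \<in> I \<and> s i \<subseteq> T. p i * 1)"
    using total_in_T by simp
  also have "\<dots> \<le> (\<Sum>i | i \<in> I \<and> s i \<subseteq> T. p i * cover_prob I p s k q (R \<union> s i))"
    using Suc p_weights(2) by (intro sum_mono mult_left_mono) auto
  also have "\<dots> \<le> cover_prob I p s k (Suc q) R"
    unfolding cover_prob.simps using p_weights by (intro sum_mono2) (auto simp: cover_prob_nonneg)
  finally show ?case .
qed

lemma cover_potential_Un_le:
  assumes "finite T" "finite A"
  shows "cover_potential k (T \<union> A) \<le> cover_potential k T / 2 * (1 + of_bool (A \<subseteq> T))"
proof (cases "A \<subseteq> T")
  case True
  then show ?thesis
    by (simp add: Un_absorb2)
next
  case False
  then have card_less: "card T < card (T \<union> A)"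
    using assms by (intro psubset_card_mono) auto
  then have "(2::real) * 2 ^ (k - card (T \<union> A)) \<le> 2 ^ (k - card T)" if "card (T \<union> A) \<le> k"
    unfolding power_Suc[symmetric] using that by (intro power_increasing) auto
  then show ?thesis
    using False card_less by (auto simp: cover_potential_def)
qed

lemma expected_cover_potential_le:
  assumes p_distribution: "finite I" "\<And>i. i \<in> I \<Longrightarrow> 0 \<le> p i" "(\<Sum>i\<in>I. p i) = 1" "\<And>i. i \<in> I \<Longrightarrow> finite (s i)"
    and T_escape: "finite T" "card T \<le> k \<Longrightarrow> (\<Sum>i | i \<in> I \<and> s i \<subseteq> T. p i) \<le> 1 - \<delta>"
  shows "(\<Sum>i\<in>I. p i * cover_potential k (T \<union> s i)) \<le> (1 - \<delta> / 2) * cover_potential k T"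
proof -
  let ?g = "cover_potential k T / 2"
  have "(\<Sum>i\<in>I. p i * cover_potential k (T \<union> s i)) \<le> (\<Sum>i\<in>I. p i * (?g * (1 + of_bool (s i \<subseteq> T))))"
    using p_distribution T_escape(1) by (intro sum_mono mult_left_mono cover_potential_Un_le) auto
  also have "\<dots> = ?g * ((\<Sum>i\<in>I. p i) + (\<Sum>i\<in>I. p i * of_bool (s i \<subseteq> T)))"
    unfolding sum.distrib[symmetric] sum_distrib_left by (intro sum.cong refl) (simp add: algebra_simps)
  also have "\<dots> = ?g * (1 + (\<Sum>i | i \<in> I \<and> s i \<subseteq> T. p i))"
    using p_distribution(1,3) by (simp add: Int_def)
  also have "\<dots> \<le> ?g * (1 + (1 - \<delta>))"
    using T_escape(2) by (cases "card T \<le> k") (auto simp: cover_potential_def)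
  finally show ?thesis
    by (simp add: algebra_simps)
qed

lemma cover_prob_le:
  assumes p_distribution: "finite I" "\<And>i. i \<in> I \<Longrightarrow> 0 \<le> p i" "(\<Sum>i\<in>I. p i) = 1" "\<And>i. i \<in> I \<Longrightarrow> s i \<subseteq> S"
    and S_escape: "finite S" "\<And>T. T \<subseteq> S \<Longrightarrow> card T \<le> k \<Longrightarrow> (\<Sum>i | i \<in> I \<and> s i \<subseteq> T. p i) \<le> 1 - \<delta>"
    and \<delta>_le_2: "\<delta> \<le> 2" and T_subset: "T \<subseteq> S"
  shows "cover_prob I p s k q T \<le> (1 - \<delta> / 2) ^ q * cover_potential k T"
  using T_subset
proof (induction q arbitrary: T)
  case 0
  then show ?case
    by (simp add: cover_potential_def)
next
  case (Suc q)
  have "cover_prob I p s k (Suc q) T \<le> (\<Sum>i\<in>I. p i * ((1 - \<delta> / 2) ^ q * cover_potential k (T \<union> s i)))"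
    unfolding cover_prob.simps using p_distribution Suc.prems by (intro sum_mono mult_left_mono Suc.IH) auto
  also have "\<dots> = (1 - \<delta> / 2) ^ q * (\<Sum>i\<in>I. p i * cover_potential k (T \<union> s i))"
    by (simp add: sum_distrib_left mult.left_commute)
  also have "\<dots> \<le> (1 - \<delta> / 2) ^ q * ((1 - \<delta> / 2) * cover_potential k T)"
    using p_distribution S_escape Suc.prems \<delta>_le_2 finite_subset[OF _ S_escape(1)]
    by (intro mult_left_mono expected_cover_potential_le) auto
  finally show ?case
    by (simp add: mult.assoc mult.left_commute)
qed

section \<open>The tester\<close>

lemma exists_constant_qalg:
  assumes N_pos: "N \<ge> 1"
  shows "\<exists>A. qalg_of_shape N 1 0 A \<and> (\<forall>U. accept_prob A U = of_bool P)"
proof -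
  define A where "A = \<lparr>anc = 1, init = unit_vec N 0, ops = [], acc = (if P then 1\<^sub>m N else 0\<^sub>m N N)\<rparr>"
  have "vnorm_sq (unit_vec N 0) = (\<Sum>i<N. if i = 0 then 1 else 0)"
    unfolding vnorm_sq_def by (intro sum.cong) auto
  then have unit_norm: "vnorm_sq (unit_vec N 0) = 1"
    using N_pos by simp
  moreover have "adj (1\<^sub>m N) = 1\<^sub>m N" "adj (0\<^sub>m N N) = 0\<^sub>m N N"
    by (auto simp: adj_def)
  ultimately have "qalg_of_shape N 1 0 A"
    by (simp add: A_def qalg_of_shape_def valid_qalg_def num_queries_def)
  moreover have "accept_prob A U = of_bool P" for U
    using unit_norm by (simp add: A_def accept_prob_def final_state_def) (simp add: vnorm_sq_def)
  ultimately show ?thesis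
    by blast
qed

lemma exists_basis_sampling_qalg:
  assumes N_pos: "N \<ge> 1" and e_basis: "operator_basis N e"
  shows "\<exists>d\<ge>1. \<forall>T. \<exists>A. qalg_of_shape N d q A \<and> (\<forall>U\<in>carrier_mat N N. accept_prob A U
    = cover_prob {..<N * N} (\<lambda>i. (cmod (basis_coeff N e (entries U) i))\<^sup>2) s k q T)"
proof (induction q)
  case 0
  have "\<exists>A. qalg_of_shape N 1 0 A \<and> (\<forall>U. accept_prob A U = of_bool (card T \<le> k))" for T :: "'a set"
    by (rule exists_constant_qalg[OF N_pos])
  then show ?case
    unfolding cover_prob.simps by (meson order_refl)
next
  case (Suc q)
  let ?m = "N * N" and ?c = "\<lambda>U. basis_coeff N e (entries U)"
  obtain d A where d_pos: "d \<ge> 1" and A_shape: "\<And>T. qalg_of_shape N d q (A T)"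
    and accept_A: "\<And>T U. U \<in> carrier_mat N N \<Longrightarrow>
      accept_prob (A T) U = cover_prob {..<?m} (\<lambda>i. (cmod (?c U i))\<^sup>2) s k q T"
    using Suc.IH by metis
  have "\<exists>B. qalg_of_shape N (d * ?m) (Suc q) B \<and> (\<forall>U\<in>carrier_mat N N.
      accept_prob B U = cover_prob {..<?m} (\<lambda>i. (cmod (?c U i))\<^sup>2) s k (Suc q) T)" for T
  proof -
    obtain W where W_unitary: "unitary_mat (N * d * ?m) W" and W_measures: "\<And>M. W *\<^sub>v choi_vec N d ?m M
        = block_vec (N * d) ?m (\<lambda>i. basis_coeff N e M i \<cdot>\<^sub>v init (A (T \<union> s i)))"
      using exists_basis_measurement[OF N_pos d_pos e_basis, of "\<lambda>i. init (A (T \<union> s i))"]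
        qalg_of_shape_init_carrier[OF A_shape] qalg_of_shape_init_unit[OF A_shape]
      by blast
    let ?B = "branch_qalg N d ?m q W (\<lambda>i. A (T \<union> s i))"
    have "qalg_of_shape N (d * ?m) (Suc q) ?B"
      using N_pos by (intro qalg_of_shape_branch_qalg W_unitary A_shape) simp_all
    moreover have "accept_prob ?B U = cover_prob {..<?m} (\<lambda>i. (cmod (?c U i))\<^sup>2) s k (Suc q) T"
      if "U \<in> carrier_mat N N" for U
      using accept_prob_branch_qalg[OF that A_shape W_measures] accept_A[OF that] by simp
    ultimately show ?thesis
      by blast
  qed
  moreover have "d * ?m \<ge> 1"
    using N_pos d_pos by simp
  ultimately show ?case
    by blast
qed

definition pauli_index :: "nat \<Rightarrow> nat \<Rightarrow> nat set \<times> nat set" where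
  "pauli_index n i = (set_decode (i div 2 ^ n), set_decode (i mod 2 ^ n))"

definition pauli_entry :: "nat \<Rightarrow> nat \<Rightarrow> nat \<Rightarrow> nat \<Rightarrow> complex" where
  "pauli_entry n i x y = (case pauli_index n i of (a,b) \<Rightarrow> pauli a b (set_decode x) (set_decode y))"

lemma bij_betw_pauli_index: "bij_betw (pauli_index n) {..<2 ^ n * 2 ^ n} (Pow {..<n} \<times> Pow {..<n})"
proof -
  have "bij_betw (\<lambda>t::nat. (t div 2 ^ n, t mod 2 ^ n)) {..<2 ^ n * 2 ^ n} ({..<2 ^ n} \<times> {..<2 ^ n})"
    by (rule bij_betw_div_mod)
  from bij_betw_trans[OF this bij_betw_map_prod[OF bij_betw_set_decode bij_betw_set_decode]]
  show ?thesis
    by (simp add: pauli_index_def[abs_def] comp_def)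
qed

lemma hs_inner_on_pauli_entry:
  assumes "pauli_index n i = (a, b)"
  shows "hs_inner_on {..<2 ^ n} (pauli_entry n i) M
    = hs_inner_on (Pow {..<n}) (pauli a b) (\<lambda>X Y. M (set_encode X) (set_encode Y))"
  unfolding hs_inner_on_reindex[OF bij_betw_set_encode]
  by (intro hs_inner_on_cong) (simp_all add: pauli_entry_def assms set_decode_set_encode)

lemma basis_coeff_pauli_entry:
  "basis_coeff (2 ^ n) (pauli_entry n) M i = (case pauli_index n i of (a,b) \<Rightarrow>
     pauli_coeff {..<n} (\<lambda>X Y. M (set_encode X) (set_encode Y)) a b)"
  by (cases "pauli_index n i") (simp add: basis_coeff_def pauli_coeff_def hs_inner_on_pauli_entry)

lemma operator_basis_pauli_entry: "operator_basis (2 ^ n) (pauli_entry n)"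
proof -
  let ?N = "2 ^ n :: nat" and ?S = "{..<n}"
  have "hs_inner_on {..<?N} (pauli_entry n i) (pauli_entry n j) = of_nat ?N * of_bool (i = j)"
    if indices: "i < ?N * ?N" "j < ?N * ?N" for i j
  proof -
    obtain a b a' b' where pauli_indices: "pauli_index n i = (a, b)" "pauli_index n j = (a', b')"
      by force
    have "(a, b) \<in> Pow ?S \<times> Pow ?S" "(a', b') \<in> Pow ?S \<times> Pow ?S"
      using bij_betw_apply[OF bij_betw_pauli_index] indices unfolding pauli_indices[symmetric] by blast+
    moreover have "(a, b) = (a', b') \<longleftrightarrow> i = j"
      using inj_on_eq_iff[OF bij_betw_imp_inj_on[OF bij_betw_pauli_index]] indices
      unfolding pauli_indices[symmetric] by blast
    moreover have "hs_inner_on {..<?N} (pauli_entry n i) (pauli_entry n j)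
        = hs_inner_on (Pow ?S) (pauli a b) (pauli a' b')"
      unfolding hs_inner_on_pauli_entry[OF pauli_indices(1)]
      by (intro hs_inner_on_cong) (simp_all add: pauli_entry_def pauli_indices set_decode_set_encode)
    ultimately show ?thesis
      by (simp add: pauli_orthogonal)
  qed
  moreover have "M x y = (\<Sum>i<?N * ?N. basis_coeff ?N (pauli_entry n) M i * pauli_entry n i x y)"
    if indices: "x < ?N" "y < ?N" for M x y
  proof -
    have "(\<Sum>i<?N * ?N. basis_coeff ?N (pauli_entry n) M i * pauli_entry n i x y)
      = (\<Sum>(a,b)\<in>Pow ?S \<times> Pow ?S. pauli_coeff ?S (\<lambda>X Y. M (set_encode X) (set_encode Y)) a b
          * pauli a b (set_decode x) (set_decode y))"
      unfolding sum.reindex_bij_betw[OF bij_betw_pauli_index, symmetric]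
      by (intro sum.cong refl) (simp add: basis_coeff_pauli_entry pauli_entry_def split: prod.split)
    then show ?thesis
      using pauli_expansion[of ?S "set_decode x" "set_decode y"] set_decode_subset indices by simp
  qed
  ultimately show ?thesis
    unfolding operator_basis_def by blast
qed

text \<open>The operator \<open>X\<^sup>aZ\<^sup>b\<close> acts nontrivially on exactly the qubits in \<open>a \<union> b\<close>.\<close>

definition pauli_cover_prob :: "nat \<Rightarrow> nat \<Rightarrow> nat \<Rightarrow> complex mat \<Rightarrow> real" where
  "pauli_cover_prob n k q U = cover_prob (Pow {..<n} \<times> Pow {..<n})
     (\<lambda>(a,b). (cmod (pauli_coeff {..<n} (set_entry U) a b))\<^sup>2) (\<lambda>(a,b). a \<union> b) k q {}"

lemma exists_pauli_sampling_qalg: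
  "\<exists>A. valid_qalg (2 ^ n) A \<and> num_queries A = q \<and>
     (\<forall>U\<in>carrier_mat (2 ^ n) (2 ^ n). accept_prob A U = pauli_cover_prob n k q U)"
proof -
  let ?N = "2 ^ n :: nat" and ?s = "\<lambda>(a,b). a \<union> b"
  obtain d A where A_shape: "qalg_of_shape ?N d q A"
    and accept_A: "\<And>U. U \<in> carrier_mat ?N ?N \<Longrightarrow> accept_prob A U
      = cover_prob {..<?N * ?N} (\<lambda>i. (cmod (basis_coeff ?N (pauli_entry n) (entries U) i))\<^sup>2)
          (\<lambda>i. ?s (pauli_index n i)) k q {}"
    using exists_basis_sampling_qalg[OF _ operator_basis_pauli_entry] by fastforce
  have "accept_prob A U = pauli_cover_prob n k q U" if "U \<in> carrier_mat ?N ?N" for U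
    unfolding pauli_cover_prob_def cover_prob_reindex[OF bij_betw_pauli_index] accept_A[OF that]
      basis_coeff_pauli_entry set_entry_def[abs_def]
    by (simp add: case_prod_unfold)
  then show ?thesis
    using A_shape by (auto simp: qalg_of_shape_def)
qed

lemma pauli_weight_eq_sum_supports:
  assumes "T \<subseteq> S"
  shows "(\<Sum>i | i \<in> Pow S \<times> Pow S \<and> (case i of (a,b) \<Rightarrow> a \<union> b) \<subseteq> T.
      case i of (a,b) \<Rightarrow> (cmod (pauli_coeff S u a b))\<^sup>2) = pauli_weight S u T"
proof -
  have "{i \<in> Pow S \<times> Pow S. (case i of (a,b) \<Rightarrow> a \<union> b) \<subseteq> T} = Pow T \<times> Pow T"
    using assms by auto
  then show ?thesis
    by (simp add: pauli_weight_def)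
qed

lemma pauli_cover_prob_has_property:
  assumes "has_property (juntas n k) U"
  shows "1 \<le> pauli_cover_prob n k q U"
proof -
  obtain T where "T \<subseteq> {..<n}" "card T = k" "pauli_weight {..<n} (set_entry U) T = 1"
    using has_property_pauli_weight[OF assms] by blast
  then show ?thesis
    unfolding pauli_cover_prob_def
    by (intro cover_prob_ge_1[where T=T])
      (auto simp: pauli_weight_eq_sum_supports intro: finite_subset)
qed

lemma pauli_cover_prob_eps_far:
  assumes U_unitary: "unitary_mat (2 ^ n) U" and far: "eps_far (2 ^ n) (juntas n k) \<epsilon> U"
    and \<epsilon>_range: "0 < \<epsilon>" "\<epsilon> \<le> 1" and k_le_n: "k \<le> n"
  shows "pauli_cover_prob n k q U \<le> (1 - \<epsilon>\<^sup>2 / 2) ^ q * 2 ^ k"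
proof -
  let ?I = "Pow {..<n} \<times> Pow {..<n}" and ?p = "\<lambda>(a,b). (cmod (pauli_coeff {..<n} (set_entry U) a b))\<^sup>2"
  have "(\<Sum>i\<in>?I. ?p i) = 1"
    using pauli_weight_unitary[OF U_unitary] by (simp add: pauli_weight_def)
  moreover have "(\<Sum>i | i \<in> ?I \<and> (case i of (a,b) \<Rightarrow> a \<union> b) \<subseteq> T. ?p i) \<le> 1 - \<epsilon>\<^sup>2"
    if "T \<subseteq> {..<n}" "card T \<le> k" for T
    unfolding pauli_weight_eq_sum_supports[OF that(1)]
    by (rule eps_far_juntas_pauli_weight_le[OF U_unitary far \<epsilon>_range(1) that k_le_n])
  moreover have "\<epsilon>\<^sup>2 \<le> 2"
    using power_le_one[of \<epsilon> 2] \<epsilon>_range by simp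
  ultimately have "pauli_cover_prob n k q U \<le> (1 - \<epsilon>\<^sup>2 / 2) ^ q * cover_potential k ({}::nat set)"
    unfolding pauli_cover_prob_def by (intro cover_prob_le[where S="{..<n}"]) auto
  then show ?thesis
    by (simp add: cover_potential_def)
qed

lemma eps_far_juntas_le_1:
  assumes U_unitary: "unitary_mat (2 ^ n) U" and far: "eps_far (2 ^ n) (juntas n k) \<epsilon> U" and "\<epsilon> > 0" "k \<le> n"
  shows "\<epsilon> \<le> 1"
proof -
  have "0 \<le> pauli_weight {..<n} (set_entry U) {}"
    by (simp add: pauli_weight_def)
  also have "\<dots> \<le> 1 - \<epsilon>\<^sup>2"
    using eps_far_juntas_pauli_weight_le[OF U_unitary far \<open>\<epsilon> > 0\<close> _ _ \<open>k \<le> n\<close>] by simp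
  finally show ?thesis
    using power2_le_imp_le[of \<epsilon> 1] by simp
qed

lemma power_decay_le_third:
  fixes \<delta> :: real
  assumes "k \<ge> 1" "0 < \<delta>" "\<delta> \<le> 1" "real q \<ge> 6 * real k / \<delta>"
  shows "(1 - \<delta> / 2) ^ q * 2 ^ k \<le> 1 / 3"
proof -
  have "(2::real) ^ 3 \<le> exp 1 ^ 3"
    using exp_ge_add_one_self[of 1] by (intro power_mono) auto
  also have "exp 1 ^ 3 = exp (3::real)"
    by (simp flip: exp_of_nat_mult)
  finally have two_div_exp_3_le: "2 / exp 3 \<le> (1 / 3 :: real)"
    by (simp add: divide_simps)
  have "(1 - \<delta> / 2) ^ q \<le> exp (- \<delta> / 2) ^ q"
    using assms exp_ge_add_one_self[of "- \<delta> / 2"] by (intro power_mono) auto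
  also have "\<dots> = exp (- (real q * \<delta> / 2))"
    by (simp flip: exp_of_nat_mult)
  also have "\<dots> \<le> exp (- (3 * real k))"
    using assms by (simp add: field_simps)
  also have "\<dots> = (1 / exp 3) ^ k"
    by (simp add: exp_minus exp_of_nat2_mult power_one_over field_simps flip: exp_of_nat_mult)
  finally have "(1 - \<delta> / 2) ^ q * 2 ^ k \<le> (1 / exp 3) ^ k * 2 ^ k"
    by (rule mult_right_mono) simp
  also have "\<dots> = (2 / exp 3) ^ k"
    by (simp add: power_divide)
  also have "\<dots> \<le> (1 / 3) ^ k"
    using two_div_exp_3_le by (intro power_mono) simp_all
  also have "\<dots> \<le> (1 / 3) ^ 1"
    using assms by (intro power_decreasing) auto
  finally show ?thesis
    by simp
qed

lemma eps_tests_pauli_sampling: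
  assumes accept_A: "\<And>U. U \<in> carrier_mat (2 ^ n) (2 ^ n) \<Longrightarrow> accept_prob A U = pauli_cover_prob n k q U"
    and k_range: "1 \<le> k" "k \<le> n" and \<epsilon>_pos: "\<epsilon> > 0" and q_large: "\<epsilon> \<le> 1 \<Longrightarrow> 6 * real k / \<epsilon>\<^sup>2 \<le> real q"
  shows "eps_tests (2 ^ n) A (juntas n k) \<epsilon>"
  unfolding eps_tests_def
proof (intro allI impI conjI)
  fix U assume U_unitary: "unitary_mat (2 ^ n) U"
  then have accept_eq: "accept_prob A U = pauli_cover_prob n k q U"
    by (simp add: accept_A unitary_mat_def)
  show "2 / 3 \<le> accept_prob A U" if "has_property (juntas n k) U"
    using pauli_cover_prob_has_property[OF that, of q] by (simp add: accept_eq)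
  show "accept_prob A U \<le> 1 / 3" if far: "eps_far (2 ^ n) (juntas n k) \<epsilon> U"
  proof -
    have \<epsilon>_le_1: "\<epsilon> \<le> 1"
      by (rule eps_far_juntas_le_1[OF U_unitary far \<epsilon>_pos k_range(2)])
    have "accept_prob A U \<le> (1 - \<epsilon>\<^sup>2 / 2) ^ q * 2 ^ k"
      unfolding accept_eq by (rule pauli_cover_prob_eps_far[OF U_unitary far \<epsilon>_pos \<epsilon>_le_1 k_range(2)])
    also have "\<dots> \<le> 1 / 3"
      using \<epsilon>_pos \<epsilon>_le_1 by (intro power_decay_le_third k_range(1) q_large) (simp_all add: power_le_one)
    finally show ?thesis .
  qed
qed

lemma sample_count_le:
  assumes "1 \<le> k" "0 < \<epsilon>" "\<epsilon> \<le> 1"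
  shows "real (nat \<lceil>6 * real k / \<epsilon>\<^sup>2\<rceil>) \<le> 7 * real k * max 1 (ln (real k / \<epsilon>)) / \<epsilon>\<^sup>2"
proof -
  have "\<epsilon>\<^sup>2 \<le> 1 * real k"
    using assms power_le_one[of \<epsilon> 2] by simp
  then have "1 \<le> real k / \<epsilon>\<^sup>2"
    using assms by (simp add: le_divide_eq)
  have "real (nat \<lceil>6 * real k / \<epsilon>\<^sup>2\<rceil>) \<le> 6 * (real k / \<epsilon>\<^sup>2) + 1"
    using assms by simp
  also have "\<dots> \<le> 7 * (real k / \<epsilon>\<^sup>2)"
    using \<open>1 \<le> real k / \<epsilon>\<^sup>2\<close> by linarith
  also have "\<dots> = 7 * real k / \<epsilon>\<^sup>2"
    by simp
  also have "\<dots> \<le> 7 * real k * max 1 (ln (real k / \<epsilon>)) / \<epsilon>\<^sup>2"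
    using mult_left_mono[of 1 "max 1 (ln (real k / \<epsilon>))" "7 * real k"] by (intro divide_right_mono) auto
  finally show ?thesis .
qed

theorem theorem2:
  shows "\<exists>C::real. \<forall>n k::nat. \<forall>\<epsilon>::real.
           1 \<le> n \<longrightarrow> 1 \<le> k \<longrightarrow> k \<le> n \<longrightarrow> \<epsilon> > 0 \<longrightarrow>
           (\<exists>A. valid_qalg (2^n) A \<and> eps_tests (2^n) A (juntas n k) \<epsilon> \<and>
                real (num_queries A) \<le> C * real k * max 1 (ln (real k / \<epsilon>)) / \<epsilon>\<^sup>2)"
proof (intro exI[of _ 7] allI impI)
  fix n k :: nat and \<epsilon> :: real
  assume k_range: "1 \<le> k" "k \<le> n" and \<epsilon>_pos: "\<epsilon> > 0"
  define q where "q = (if \<epsilon> \<le> 1 then nat \<lceil>6 * real k / \<epsilon>\<^sup>2\<rceil> else 0)"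
  obtain A where A_valid: "valid_qalg (2 ^ n) A" "num_queries A = q"
    and accept_A: "\<And>U. U \<in> carrier_mat (2 ^ n) (2 ^ n) \<Longrightarrow> accept_prob A U = pauli_cover_prob n k q U"
    using exists_pauli_sampling_qalg by blast
  have "eps_tests (2 ^ n) A (juntas n k) \<epsilon>"
    using eps_tests_pauli_sampling[OF accept_A k_range \<epsilon>_pos] by (simp add: q_def real_nat_ceiling_ge)
  moreover have "real (num_queries A) \<le> 7 * real k * max 1 (ln (real k / \<epsilon>)) / \<epsilon>\<^sup>2"
    using sample_count_le[OF k_range(1) \<epsilon>_pos] by (simp add: A_valid(2) q_def)
  ultimately show "\<exists>A. valid_qalg (2^n) A \<and> eps_tests (2^n) A (juntas n k) \<epsilon> \<and>
                real (num_queries A) \<le> 7 * real k * max 1 (ln (real k / \<epsilon>)) / \<epsilon>\<^sup>2"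
    using A_valid(1) by blast
qed

end
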